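(* Let $n\ge2$ be an integer and let $G$ be a subgroup of $\Pi_d$ (with $d\ge 2$) that acts transitively on $\{1,\dots,d\}$. Then for $\mu_+$-almost every $\psi_+\in\mathrm{Hom}(\Gamma^+,G)$, the skew product $E_{\psi_+}:X_n\times\{1,\dots,d\}\to X_n\times\{1,\dots,d\}$ over the $n$-adic odometer is uniquely ergodic.
   Context: $\Pi_d$ is the symmetric group on $\{1,\dots,d\}$. $\mathbb N=\{1,2,3,\dots\}$. $X_n=\{0,\dots,n-1\}^{\mathbb N}$ with the product topology. For $x\in X_n$ let $\kappa(x)\in\mathbb N\cup\{+\infty\}$ be the smallest index $k$ with $x_k\ne n-1$, or $+\infty$ if there is none. The $n$-adic odometer $\Omega_n:X_n\to X_n$ is addition of $1$ with infinite carry to the right: $\Omega_n(x)=(0,\dots,0,x_{\kappa(x)}+1,x_{\kappa(x)+1},x_{\kappa(x)+2},\dots)$, where the first $\kappa(x)-1$ entries are $0$ and the $\kappa(x)$-th entry is $x_{\kappa(x)}+1$. $\Gamma^+$ is the free group on the countably infinite set $\{\gamma_i:i\in\mathbb N\}$. For $\psi_+\in\mathrm{Hom}(\Gamma^+,G)$, define $E_{\psi_+}(x,m)=\big(\Omega_n(x),\psi_+(\gamma_{\kappa(x)})(m)\big)$. This is well defined unless $\kappa(x)=+\infty$; this issue is ignored because off a countable set all points have well-defined orbits. Uniquely ergodic means that there is exactly one invariant Borel probability measure. $\mu_+$ is the product measure on $\mathrm{Hom}(\Gamma^+,G)$ (identified with $G^{\mathbb N}$ via $\psi_+\mapsto(\psi_+(\gamma_i))_i$),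 i.e. the Borel probability measure with $\mu_+(\{h:h(\gamma_{e_i})=\sigma_i,\ i=1,\dots,k\})=|G|^{-k}$ for distinct $e_1,\dots,e_k\in\mathbb N$ and any $\sigma_1,\dots,\sigma_k\in G$. *)

theory Defs
  imports "HOL-Probability.Probability" "HOL-Algebra.Sym_Groups" "HOL-Library.Extended_Nat"
begin

section \<open>Free groups\<close>

text \<open>
  The elements are the reduced words in the letters \<open>(b, i)\<close>, where \<open>(True, i)\<close> stands
  for the generator \<open>i\<close> and \<open>(False, i)\<close> for its inverse.
\<close>

definition inverse_letter :: "bool \<times> 'a \<Rightarrow> bool \<times> 'a" where
  "inverse_letter l = (\<not> fst l, snd l)"

definition reduced_word :: "(bool \<times> 'a) list \<Rightarrow> bool" where
  "reduced_word = successively (\<lambda>l l'. l' \<noteq> inverse_letter l)"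

fun push_letter :: "bool \<times> 'a \<Rightarrow> (bool \<times> 'a) list \<Rightarrow> (bool \<times> 'a) list" where
  "push_letter l [] = [l]"
| "push_letter l (l' # w) = (if l' = inverse_letter l then w else l # l' # w)"

definition free_group :: "'a set \<Rightarrow> (bool \<times> 'a) list monoid" where
  "free_group S =
     \<lparr>carrier = {w. reduced_word w \<and> snd ` set w \<subseteq> S},
      monoid.mult = foldr push_letter,
      one = []\<rparr>"

definition free_gen :: "'a \<Rightarrow> (bool \<times> 'a) list" where
  "free_gen i = [(True, i)]"

lemma inverse_letter_idem [simp]: "inverse_letter (inverse_letter l) = l"
  by (simp add: inverse_letter_def)

lemma snd_inverse_letter [simp]: "snd (inverse_letter l) = snd l"
  by (simp add: inverse_letter_def)

lemma inverse_letter_neq [simp]: "inverse_letter l \<noteq> l" "l \<noteq> inverse_letter l"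
  by (cases l; simp add: inverse_letter_def)+

lemma reduced_simps [simp]:
  "reduced_word []" "reduced_word [l]"
  "reduced_word (l # l' # w) \<longleftrightarrow> l' \<noteq> inverse_letter l \<and> reduced_word (l' # w)"
  by (simp_all add: reduced_word_def)

lemma reduced_ConsD: "reduced_word (l # w) \<Longrightarrow> reduced_word w"
  by (cases w) auto

lemma push_letter_reduced_Cons: "reduced_word (l # w) \<Longrightarrow> push_letter l w = l # w"
  by (cases w) auto

lemma reduced_push_letter: "reduced_word w \<Longrightarrow> reduced_word (push_letter l w)"
  by (cases w) (auto dest: reduced_ConsD)

lemma reduced_foldr: "reduced_word v \<Longrightarrow> reduced_word (foldr push_letter u v)"
  by (induction u) (auto intro: reduced_push_letter)

lemma push_letter_cancel:
  "reduced_word w \<Longrightarrow> push_letter l (push_letter (inverse_letter l) w) = w"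
  by (cases w) (auto simp: push_letter_reduced_Cons)

lemma snd_set_push_letter: "snd ` set (push_letter l w) \<subseteq> insert (snd l) (snd ` set w)"
  by (cases w) auto

lemma snd_set_foldr:
  "snd ` set (foldr push_letter u v) \<subseteq> snd ` set u \<union> snd ` set v"
proof (induction u)
  case (Cons l u)
  have "snd ` set (foldr push_letter (l # u) v) \<subseteq>
      insert (snd l) (snd ` set (foldr push_letter u v))"
    using snd_set_push_letter[of l "foldr push_letter u v"] by simp
  also have "\<dots> \<subseteq> snd ` set (l # u) \<union> snd ` set v"
    using Cons.IH by auto
  finally show ?case .
qed simp

lemma foldr_push_letter:
  assumes "reduced_word v"
  shows "foldr push_letter (push_letter l u) v = push_letter l (foldr push_letter u v)"
proof (cases u)
  case (Cons l' u')
  show ?thesis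
    using push_letter_cancel[of "foldr push_letter u' v" l] reduced_foldr[OF assms]
    by (auto simp: Cons)
qed simp

lemma foldr_foldr_push_letter:
  "reduced_word v \<Longrightarrow>
     foldr push_letter (foldr push_letter t u) v = foldr push_letter t (foldr push_letter u v)"
  by (induction t) (auto simp: foldr_push_letter)

lemma foldr_push_letter_Nil: "reduced_word u \<Longrightarrow> foldr push_letter u [] = u"
proof (induction u)
  case (Cons l u)
  then show ?case
    by (simp add: push_letter_reduced_Cons reduced_ConsD)
qed simp

lemma foldr_inverse_letters:
  assumes "reduced_word v"
  shows "foldr push_letter (rev (map inverse_letter u)) (foldr push_letter u v) = v"
proof (induction u)
  case (Cons l u)
  then show ?case
    using push_letter_cancel[of "foldr push_letter u v" "inverse_letter l"]
      reduced_foldr[OF assms, of u]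
    by simp
qed simp

lemma group_free_group: "group (free_group S)"
proof (rule groupI)
  fix x y assume xy: "x \<in> carrier (free_group S)" "y \<in> carrier (free_group S)"
  have "snd ` set (foldr push_letter x y) \<subseteq> S"
    using xy by (intro order_trans[OF snd_set_foldr]) (simp add: free_group_def)
  then show "x \<otimes>\<^bsub>free_group S\<^esub> y \<in> carrier (free_group S)"
    using xy by (simp add: free_group_def reduced_foldr)
next
  fix x assume x: "x \<in> carrier (free_group S)"
  let ?y = "foldr push_letter (rev (map inverse_letter x)) []"
  have "snd ` set ?y \<subseteq> S"
    using snd_set_foldr[of "rev (map inverse_letter x)" "[]"] x
    by (force simp: free_group_def)
  moreover have "foldr push_letter ?y x = []"
    using x foldr_inverse_letters[of "[]" x]
    by (simp add: free_group_def foldr_foldr_push_letter foldr_push_letter_Nil)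
  ultimately show "\<exists>y\<in>carrier (free_group S). y \<otimes>\<^bsub>free_group S\<^esub> x = \<one>\<^bsub>free_group S\<^esub>"
    by (intro bexI[of _ ?y]) (auto simp: free_group_def reduced_foldr)
qed (auto simp: free_group_def foldr_foldr_push_letter)

lemma free_gen_in_free_group: "i \<in> S \<Longrightarrow> free_gen i \<in> carrier (free_group S)"
  by (simp add: free_group_def free_gen_def)

text \<open>The universal property: homomorphisms are determined by arbitrary values on generators.\<close>

definition letter_value :: "('b, 'c) monoid_scheme \<Rightarrow> ('a \<Rightarrow> 'b) \<Rightarrow> bool \<times> 'a \<Rightarrow> 'b" where
  "letter_value G f l = (if fst l then f (snd l) else inv\<^bsub>G\<^esub> f (snd l))"

definition word_value :: "('b, 'c) monoid_scheme \<Rightarrow> ('a \<Rightarrow> 'b) \<Rightarrow> (bool \<times> 'a) list \<Rightarrow> 'b" where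
  "word_value G f w = foldr (\<lambda>l. mult G (letter_value G f l)) w \<one>\<^bsub>G\<^esub>"

context group
begin

lemma letter_value_closed:
  "f \<in> S \<rightarrow> carrier G \<Longrightarrow> snd l \<in> S \<Longrightarrow> letter_value G f l \<in> carrier G"
  by (auto simp: letter_value_def)

lemma word_value_closed:
  "f \<in> S \<rightarrow> carrier G \<Longrightarrow> snd ` set w \<subseteq> S \<Longrightarrow> word_value G f w \<in> carrier G"
  by (induction w) (auto simp: word_value_def letter_value_closed)

lemma letter_value_inverse:
  assumes "f \<in> S \<rightarrow> carrier G" "snd l \<in> S" "x \<in> carrier G"
  shows "letter_value G f l \<otimes> (letter_value G f (inverse_letter l) \<otimes> x) = x"
proof -
  have "f (snd l) \<in> carrier G" using assms by auto
  then show ?thesis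
    using assms by (auto simp: letter_value_def inverse_letter_def m_assoc[symmetric])
qed

lemma word_value_push_letter:
  assumes f: "f \<in> S \<rightarrow> carrier G" and "snd l \<in> S" "snd ` set w \<subseteq> S"
  shows "word_value G f (push_letter l w) = letter_value G f l \<otimes> word_value G f w"
proof (cases w)
  case (Cons l' w')
  then show ?thesis
    using assms letter_value_inverse[OF f, of l "word_value G f w'"] word_value_closed[OF f, of w']
    by (auto simp: word_value_def)
qed (simp add: word_value_def)

lemma word_value_foldr:
  assumes f: "f \<in> S \<rightarrow> carrier G" and "snd ` set u \<subseteq> S" "snd ` set v \<subseteq> S"
  shows "word_value G f (foldr push_letter u v) = word_value G f u \<otimes> word_value G f v"
  using assms(2)
proof (induction u)
  case Nil
  then show ?case
    using word_value_closed[OF f assms(3)] by (simp add: word_value_def)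
next
  case (Cons l u)
  have "snd ` set (foldr push_letter u v) \<subseteq> S"
    using Cons.prems assms(3) by (intro order_trans[OF snd_set_foldr]) simp
  then have "word_value G f (foldr push_letter (l # u) v) =
      letter_value G f l \<otimes> (word_value G f u \<otimes> word_value G f v)"
    using Cons by (simp add: word_value_push_letter[OF f])
  also have "\<dots> = word_value G f (l # u) \<otimes> word_value G f v"
    using Cons.prems letter_value_closed[OF f, of l] word_value_closed[OF f, of u]
      word_value_closed[OF f assms(3)]
    by (simp add: word_value_def m_assoc)
  finally show ?case .
qed

lemma word_value_hom: "f \<in> S \<rightarrow> carrier G \<Longrightarrow> word_value G f \<in> hom (free_group S) G"
  by (auto simp: hom_def free_group_def word_value_foldr word_value_closed)

lemma word_value_generator: "f i \<in> carrier G \<Longrightarrow> word_value G f (free_gen i) = f i"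
  by (simp add: word_value_def letter_value_def free_gen_def)

lemma hom_free_group_eq_word_value:
  assumes h: "h \<in> hom (free_group S) G" and w: "w \<in> carrier (free_group S)"
  shows "h w = word_value G (\<lambda>i. h (free_gen i)) w"
  using w
proof (induction w)
  case Nil
  have "h \<one>\<^bsub>free_group S\<^esub> = \<one>"
    using h group_free_group group_axioms hom_one by blast
  then show ?case
    by (simp add: word_value_def free_group_def)
next
  case (Cons l w)
  interpret F: group "free_group S" by (rule group_free_group)
  interpret group_hom "free_group S" G h
    using h by unfold_locales
  have i: "snd l \<in> S" and w: "w \<in> carrier (free_group S)"
    and l: "[l] \<in> carrier (free_group S)"
    using Cons.prems by (auto simp: free_group_def dest: reduced_ConsD)
  have *: "l # w = [l] \<otimes>\<^bsub>free_group S\<^esub> w"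
    using Cons.prems by (simp add: free_group_def push_letter_reduced_Cons)
  have "h [l] = letter_value G (\<lambda>i. h (free_gen i)) l"
  proof (cases "fst l")
    case True
    then have "[l] = free_gen (snd l)"
      by (cases l) (auto simp: free_gen_def)
    then show ?thesis
      using True by (simp add: letter_value_def)
  next
    case False
    then have "[l] = [(False, snd l)]" by (cases l) auto
    moreover have "inv\<^bsub>free_group S\<^esub> free_gen (snd l) = [(False, snd l)]"
      using i by (intro F.inv_equality)
        (auto simp: free_group_def free_gen_def inverse_letter_def)
    ultimately have "[l] = inv\<^bsub>free_group S\<^esub> free_gen (snd l)" by simp
    then show ?thesis
      using False free_gen_in_free_group[OF i] by (simp add: letter_value_def hom_inv)
  qed
  moreover have "h (l # w) = h [l] \<otimes> h w"
    unfolding * using l w by (rule hom_mult)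
  ultimately show ?case
    using Cons.IH[OF w] by (simp add: word_value_def)
qed

end


section \<open>The random homomorphism\<close>

definition Gamma_plus :: "(bool \<times> nat) list monoid" where
  "Gamma_plus = free_group {1..}"

definition perm_subgroup :: "nat \<Rightarrow> (nat \<Rightarrow> nat) set \<Rightarrow> (nat \<Rightarrow> nat) monoid" where
  "perm_subgroup d G = (sym_group d)\<lparr>carrier := G\<rparr>"

text \<open>
  Extensionality fixes the otherwise arbitrary values outside the carrier, so that a
  homomorphism is represented by exactly one HOL function.
\<close>

definition Hom_plus :: "nat \<Rightarrow> (nat \<Rightarrow> nat) set \<Rightarrow> ((bool \<times> nat) list \<Rightarrow> nat \<Rightarrow> nat) set" where
  "Hom_plus d G = hom Gamma_plus (perm_subgroup d G) \<inter> extensional (carrier Gamma_plus)"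

definition generator_values ::
    "((bool \<times> nat) list \<Rightarrow> nat \<Rightarrow> nat) \<Rightarrow> nat \<Rightarrow> nat \<Rightarrow> nat" where
  "generator_values \<psi> = (\<lambda>i\<in>{1..}. \<psi> (free_gen i))"

definition mu_plus ::
    "nat \<Rightarrow> (nat \<Rightarrow> nat) set \<Rightarrow> ((bool \<times> nat) list \<Rightarrow> nat \<Rightarrow> nat) measure" where
  "mu_plus d G =
     distr (PiM {1..} (\<lambda>_. uniform_count_measure G))
       (vimage_algebra (Hom_plus d G) generator_values
          (PiM {1..} (\<lambda>_. uniform_count_measure G)))
       (the_inv_into (Hom_plus d G) generator_values)"

lemma group_perm_subgroup: "subgroup G (sym_group d) \<Longrightarrow> group (perm_subgroup d G)"
  unfolding perm_subgroup_def
  by (rule subgroup.subgroup_is_group[OF _ sym_group_is_group])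

lemma carrier_perm_subgroup [simp]: "carrier (perm_subgroup d G) = G"
  by (simp add: perm_subgroup_def)

lemma bij_betw_generator_values:
  assumes "subgroup G (sym_group d)"
  shows "bij_betw generator_values (Hom_plus d G) ({1..} \<rightarrow>\<^sub>E G)"
proof -
  interpret group "perm_subgroup d G"
    by (rule group_perm_subgroup[OF assms])
  let ?P = "perm_subgroup d G"
  show ?thesis
  proof (rule bij_betw_imageI)
    show "inj_on generator_values (Hom_plus d G)"
    proof (rule inj_onI)
      fix \<phi> \<psi> assume H: "\<phi> \<in> Hom_plus d G" "\<psi> \<in> Hom_plus d G"
        and eq: "generator_values \<phi> = generator_values \<psi>"
      have gen: "\<phi> (free_gen i) = \<psi> (free_gen i)" if "i \<in> {1..}" for i
        using fun_cong[OF eq, of i] that by (simp add: generator_values_def)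
      show "\<phi> = \<psi>"
      proof (rule extensionalityI)
        show "\<phi> \<in> extensional (carrier Gamma_plus)" "\<psi> \<in> extensional (carrier Gamma_plus)"
          using H by (auto simp: Hom_plus_def)
        fix w assume w: "w \<in> carrier Gamma_plus"
        have "word_value ?P (\<lambda>i. \<phi> (free_gen i)) w = word_value ?P (\<lambda>i. \<psi> (free_gen i)) w"
          unfolding word_value_def
        proof (rule foldr_cong)
          fix l x assume "l \<in> set w"
          then have "snd l \<in> {1..}"
            using w by (auto simp: Gamma_plus_def free_group_def)
          then show "mult ?P (letter_value ?P (\<lambda>i. \<phi> (free_gen i)) l) x =
              mult ?P (letter_value ?P (\<lambda>i. \<psi> (free_gen i)) l) x"
            by (simp add: letter_value_def gen)
        qed simp_all
        then show "\<phi> w = \<psi> w"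
          using H w hom_free_group_eq_word_value[of _ "{1..}" w]
          by (simp add: Hom_plus_def Gamma_plus_def)
      qed
    qed
    have "generator_values \<psi> \<in> {1..} \<rightarrow>\<^sub>E G" if "\<psi> \<in> Hom_plus d G" for \<psi>
      using that by (auto simp: generator_values_def Hom_plus_def Gamma_plus_def hom_def Pi_iff
          free_gen_in_free_group)
    moreover have "h \<in> generator_values ` Hom_plus d G" if h: "h \<in> {1..} \<rightarrow>\<^sub>E G" for h
    proof
      let ?\<psi> = "restrict (word_value ?P h) (carrier Gamma_plus)"
      have wv: "word_value ?P h \<in> hom Gamma_plus ?P"
        using h unfolding Gamma_plus_def by (intro word_value_hom) auto
      interpret F: group Gamma_plus
        unfolding Gamma_plus_def by (rule group_free_group)
      show "?\<psi> \<in> Hom_plus d G"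
        using wv by (auto simp: Hom_plus_def hom_def)
      show "h = generator_values ?\<psi>"
      proof (rule extensionalityI)
        show "h \<in> extensional {1..}" "generator_values ?\<psi> \<in> extensional {1..}"
          using h by (auto simp: generator_values_def PiE_def)
        fix i :: nat assume i: "i \<in> {1..}"
        then have "h i \<in> G" using h by blast
        then show "h i = generator_values ?\<psi> i"
          using i by (simp add: generator_values_def Gamma_plus_def free_gen_in_free_group
              word_value_generator)
      qed
    qed
    ultimately show "generator_values ` Hom_plus d G = ({1..} \<rightarrow>\<^sub>E G)"
      by auto
  qed
qed

lemma space_mu_plus [simp]: "space (mu_plus d G) = Hom_plus d G"
  by (simp add: mu_plus_def)

lemma subgroup_sym_group_finite:
  assumes "subgroup G (sym_group d)"
  shows "finite G" "G \<noteq> {}"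
proof -
  show "finite G"
    using subgroup.subset[OF assms] finite_permutations[of "{1..d}"]
    by (auto simp: sym_group_def intro: finite_subset)
  show "G \<noteq> {}"
    using subgroup.one_closed[OF assms] by auto
qed

lemma measurable_the_inv_generator_values:
  assumes "subgroup G (sym_group d)"
  shows "the_inv_into (Hom_plus d G) generator_values \<in>
    PiM {1..} (\<lambda>_. uniform_count_measure G) \<rightarrow>\<^sub>M
    vimage_algebra (Hom_plus d G) generator_values (PiM {1..} (\<lambda>_. uniform_count_measure G))"
    (is "?g \<in> ?M \<rightarrow>\<^sub>M _")
proof (rule measurable_vimage_algebra2)
  note bij = bij_betw_generator_values[OF assms]
  have sp: "space ?M = ({1..} \<rightarrow>\<^sub>E G)"
    by (simp add: space_PiM space_uniform_count_measure)
  show "?g \<in> space ?M \<rightarrow> Hom_plus d G"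
    unfolding sp using bij_betw_apply[OF bij_betw_the_inv_into[OF bij]] by blast
  have "(\<lambda>x. generator_values (?g x)) \<in> ?M \<rightarrow>\<^sub>M ?M \<longleftrightarrow> (\<lambda>x. x) \<in> ?M \<rightarrow>\<^sub>M ?M"
    by (intro measurable_cong f_the_inv_into_f_bij_betw[OF bij]) (simp only: sp)
  then show "(\<lambda>x. generator_values (?g x)) \<in> ?M \<rightarrow>\<^sub>M ?M"
    by simp
qed

lemma prob_space_mu_plus:
  assumes "subgroup G (sym_group d)"
  shows "prob_space (mu_plus d G)"
proof -
  interpret prob_space "PiM {1::nat..} (\<lambda>_. uniform_count_measure G)"
    using subgroup_sym_group_finite[OF assms]
    by (intro prob_space_PiM prob_space_uniform_count_measure)
  show ?thesis
    unfolding mu_plus_def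
    by (rule prob_space_distr[OF measurable_the_inv_generator_values[OF assms]])
qed

lemma emeasure_mu_plus_cylinder:
  assumes G: "subgroup G (sym_group d)"
    and J: "finite J" "J \<subseteq> {1..}" and \<sigma>: "\<And>i. i \<in> J \<Longrightarrow> \<sigma> i \<in> G"
  shows "{\<psi> \<in> Hom_plus d G. \<forall>i\<in>J. \<psi> (free_gen i) = \<sigma> i} \<in> sets (mu_plus d G)" (is "?C \<in> _")
    and "emeasure (mu_plus d G) {\<psi> \<in> Hom_plus d G. \<forall>i\<in>J. \<psi> (free_gen i) = \<sigma> i} =
      ennreal ((1 / card G) ^ card J)"
proof -
  note fin = subgroup_sym_group_finite[OF G]
  note bij = bij_betw_generator_values[OF G]
  let ?U = "uniform_count_measure G"
  let ?M = "PiM {1::nat..} (\<lambda>_. ?U)"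
  let ?g = "the_inv_into (Hom_plus d G) generator_values"
  let ?D = "{x \<in> space ?M. \<forall>i\<in>J. x i \<in> {\<sigma> i}}"
  interpret U: prob_space ?U
    using fin by (intro prob_space_uniform_count_measure)
  interpret product_prob_space "\<lambda>_. ?U" "{1::nat..}"
    by unfold_locales
  have sp: "space ?M = ({1..} \<rightarrow>\<^sub>E G)"
    by (simp add: space_PiM space_uniform_count_measure)
  have sing: "{\<sigma> i} \<in> sets ?U" if "i \<in> J" for i
    using \<sigma>[OF that] by (simp add: sets_uniform_count_measure)
  have "?D = prod_emb {1..} (\<lambda>_. ?U) J (Pi\<^sub>E J (\<lambda>i. {\<sigma> i}))"
    using J by (auto simp: prod_emb_def space_PiM Pi_iff)
  then have D: "?D \<in> sets ?M"
    using J sing by (auto intro!: sets_PiM_I)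
  have val: "generator_values \<psi> i = \<psi> (free_gen i)" if "i \<in> J" for \<psi> i
    using that J by (auto simp: generator_values_def)
  have mem: "generator_values \<psi> \<in> space ?M" if "\<psi> \<in> Hom_plus d G" for \<psi>
    unfolding sp by (rule bij_betw_apply[OF bij that])
  have "?C = generator_values -` ?D \<inter> Hom_plus d G"
    using mem val by auto
  then show C: "?C \<in> sets (mu_plus d G)"
    using in_vimage_algebra[OF D] by (simp add: mu_plus_def)
  have "?g -` ?C \<inter> space ?M = ?D"
  proof -
    have "?g x \<in> ?C \<longleftrightarrow> x \<in> ?D" if x: "x \<in> space ?M" for x
    proof -
      have "?g x \<in> Hom_plus d G" "generator_values (?g x) = x"
        using x unfolding sp
        by (rule bij_betw_apply[OF bij_betw_the_inv_into[OF bij]])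
          (rule f_the_inv_into_f_bij_betw[OF bij], use x in \<open>simp only: sp\<close>)
      then show ?thesis
        using val[of _ "?g x"] x by auto
    qed
    then show ?thesis by auto
  qed
  then have "emeasure (mu_plus d G) ?C = emeasure ?M ?D"
    using C unfolding mu_plus_def
    by (subst emeasure_distr[OF measurable_the_inv_generator_values[OF G]]) simp_all
  also have "\<dots> = (\<Prod>i\<in>J. emeasure ?U {\<sigma> i})"
    using J sing by (intro emeasure_PiM_Collect) auto
  also have "\<dots> = (\<Prod>i\<in>J. ennreal (1 / card G))"
    using fin \<sigma> by (intro prod.cong) (auto simp: emeasure_uniform_count_measure)
  also have "\<dots> = ennreal ((1 / card G) ^ card J)"
    by (simp add: ennreal_power)
  finally show "emeasure (mu_plus d G) ?C = ennreal ((1 / card G) ^ card J)" .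
qed


section \<open>The odometer and its skew products\<close>

definition digit_seqs :: "nat \<Rightarrow> (nat \<Rightarrow> nat) set" where
  "digit_seqs n = ({1..} \<rightarrow>\<^sub>E {0..<n})"

definition carry_index :: "nat \<Rightarrow> (nat \<Rightarrow> nat) \<Rightarrow> enat" where
  "carry_index n x =
     (if \<exists>k\<ge>1. x k \<noteq> n - 1 then enat (LEAST k. 1 \<le> k \<and> x k \<noteq> n - 1) else \<infinity>)"

definition odometer :: "nat \<Rightarrow> (nat \<Rightarrow> nat) \<Rightarrow> nat \<Rightarrow> nat" where
  "odometer n x =
     (\<lambda>k\<in>{1..}. if enat k < carry_index n x then 0
                else if enat k = carry_index n x then x k + 1
                else x k)"

text \<open>The skew product is a partial map, defined off the fibre over \<open>(n-1, n-1, \<dots>)\<close>.\<close>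

definition skew_product ::
    "nat \<Rightarrow> ((bool \<times> nat) list \<Rightarrow> nat \<Rightarrow> nat) \<Rightarrow> (nat \<Rightarrow> nat) \<times> nat \<rightharpoonup> (nat \<Rightarrow> nat) \<times> nat" where
  "skew_product n \<psi> = (\<lambda>(x, m).
     case carry_index n x of
       enat k \<Rightarrow> Some (odometer n x, \<psi> (free_gen k) m)
     | \<infinity> \<Rightarrow> None)"

text \<open>
  \<open>X\<^sub>n \<times> {1, \<dots>, d}\<close> with its Borel sets. As \<open>nat\<close> is discrete and function and product types
  carry the product topology, the subspace topology is the intended product topology (the
  coordinate \<open>0\<close>, which is not part of a digit sequence, is constantly \<open>undefined\<close>).
\<close>

definition skew_space :: "nat \<Rightarrow> nat \<Rightarrow> ((nat \<Rightarrow> nat) \<times> nat) measure" where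
  "skew_space n d = restrict_space borel (digit_seqs n \<times> {1..d})"

text \<open>
  Invariance of a probability measure under a partial map: preimages only contain points at
  which the map is defined. Taking \<open>A = space M\<close> shows that the map, and hence each of its
  iterates, is defined almost everywhere.
\<close>

definition invariant_prob :: "'a measure \<Rightarrow> ('a \<rightharpoonup> 'a) \<Rightarrow> 'a measure \<Rightarrow> bool" where
  "invariant_prob M T \<mu> \<longleftrightarrow>
     sets \<mu> = sets M \<and> prob_space \<mu> \<and>
     (\<forall>A\<in>sets M. emeasure \<mu> {p \<in> space M. \<exists>q\<in>A. T p = Some q} = emeasure \<mu> A)"

definition uniquely_ergodic :: "'a measure \<Rightarrow> ('a \<rightharpoonup> 'a) \<Rightarrow> bool" where
  "uniquely_ergodic M T \<longleftrightarrow> (\<exists>!\<mu>. invariant_prob M T \<mu>)"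

end

theory Submission
  imports Defs
begin

text \<open>
  Write \<open>w\<close> for the value of the first \<open>N\<close> digits in base \<open>n\<close>, least significant digit first. The
  skew product adds \<open>1\<close> to \<open>w\<close> and acts on the fibre by a generator that depends only on \<open>w + 1\<close> as
  long as \<open>w + 1 < n ^ N\<close>. So for an invariant measure \<open>\<mu>\<close> the masses of all cells of level \<open>N\<close> are
  determined by the vector \<open>q N m = n ^ N * \<mu> {w = 0, fibre point m}\<close>, and splitting a cell into \<open>n\<close>
  cells of the next level shows that \<open>q N\<close> is the average of \<open>q (N + 1)\<close> over the first \<open>n\<close> powers of
  the inverse of a permutation \<open>h N \<in> G\<close>, the return cocycle at \<open>n ^ N\<close>. For random \<open>\<psi>\<close> the \<open>h N\<close> are independent
  and uniform on \<open>G\<close>, so almost surely a block listing all of \<open>G\<close> occurs infinitely often. By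
  transitivity such a block contracts the oscillation of \<open>q\<close> by a fixed factor, hence every \<open>q N\<close>
  is constant, and \<open>\<mu>\<close> is the uniform measure.
\<close>

section \<open>Prefix values and carries\<close>

text \<open>Digit positions start at 1 and exponents at 0, whence \<open>Suc i\<close>. In terms of
  this number the odometer acts on the first \<open>N\<close> digits as addition of 1 modulo
  \<open>n ^ N\<close>.\<close>

definition prefix_value :: "nat \<Rightarrow> nat \<Rightarrow> (nat \<Rightarrow> nat) \<Rightarrow> nat" where
  "prefix_value n N x = (\<Sum>i<N. x (Suc i) * n ^ i)"

lemma prefix_value_0 [simp]: "prefix_value n 0 x = 0"
  by (simp add: prefix_value_def)

lemma prefix_value_Suc: "prefix_value n (Suc N) x = prefix_value n N x + x (Suc N) * n ^ N"
  by (simp add: prefix_value_def)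

lemma digit_seqsD: "x \<in> digit_seqs n \<Longrightarrow> 1 \<le> i \<Longrightarrow> x i < n"
  by (force simp: digit_seqs_def)

lemma prefix_value_less:
  assumes "x \<in> digit_seqs n" "n > 0"
  shows "prefix_value n N x < n ^ N"
proof (induction N)
  case (Suc N)
  have "x (Suc N) \<le> n - 1"
    using digit_seqsD[OF assms(1), of "Suc N"] by simp
  then have "x (Suc N) * n ^ N \<le> (n - 1) * n ^ N"
    by (rule mult_right_mono) simp
  then have "prefix_value n (Suc N) x < n ^ N + (n - 1) * n ^ N"
    using Suc unfolding prefix_value_Suc by linarith
  also have "\<dots> = n ^ Suc N"
    using assms(2) by (cases n) auto
  finally show ?case .
qed simp

lemma prefix_value_mod:
  assumes "x \<in> digit_seqs n" "n > 0" "M \<le> N"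
  shows "prefix_value n N x mod n ^ M = prefix_value n M x"
  using assms(3)
proof (induction N rule: dec_induct)
  case base
  show ?case using prefix_value_less[OF assms(1,2)] by simp
next
  case (step N)
  have "n ^ M dvd x (Suc N) * n ^ N"
    using step by (intro dvd_mult le_imp_power_dvd) simp
  then have "prefix_value n (Suc N) x mod n ^ M = prefix_value n N x mod n ^ M"
    by (auto simp: prefix_value_Suc elim!: dvdE)
  then show ?case using step by simp
qed

lemma prefix_value_cong:
  "(\<And>i. i \<in> {1..N} \<Longrightarrow> x i = y i) \<Longrightarrow> prefix_value n N x = prefix_value n N y"
  unfolding prefix_value_def by (intro sum.cong) auto

text \<open>Uniqueness of base-\<open>n\<close> expansions: the top digit is the quotient of the
  value by \<open>n ^ N\<close>, and induction handles the rest.\<close>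

lemma prefix_value_eq_iff:
  assumes "x \<in> digit_seqs n" "y \<in> digit_seqs n" "n > 0"
  shows "prefix_value n N x = prefix_value n N y \<longleftrightarrow> (\<forall>i\<in>{1..N}. x i = y i)"
proof (induction N)
  case (Suc N)
  have "z (Suc N) = prefix_value n (Suc N) z div n ^ N" if "z \<in> digit_seqs n" for z
    using prefix_value_less[OF that assms(3), of N] assms(3) by (simp add: prefix_value_Suc)
  then have "x (Suc N) = y (Suc N)" if "prefix_value n (Suc N) x = prefix_value n (Suc N) y"
    using assms that by metis
  then show ?case
    using Suc by (auto simp: prefix_value_Suc atLeastAtMostSuc_conv)
qed simp

lemma ex_prefix_value:
  assumes "w < n ^ N" "n > 0"
  shows "\<exists>x\<in>digit_seqs n. prefix_value n N x = w"
proof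
  \<comment> \<open>The base-\<open>n\<close> digits of \<open>w\<close>, continued by zeros. The
    claim that follows is about \<open>w mod n ^ M\<close> for every \<open>M\<close>, so that
    \<open>w\<close> stays fixed in the induction.\<close>
  let ?x = "\<lambda>i\<in>{1..}. w div n ^ (i - 1) mod n"
  have "prefix_value n M ?x = w mod n ^ M" for M
  proof (induction M)
    case (Suc M)
    then show ?case
      by (simp add: prefix_value_Suc mod_mult2_eq power_Suc2 del: power_Suc)
  qed simp
  then show "prefix_value n N ?x = w"
    using assms by simp
  show "?x \<in> digit_seqs n"
    using assms by (auto simp: digit_seqs_def)
qed

section \<open>Carries as divisibility by powers of \<open>n\<close>\<close>

lemma const_digit_seqs: "c < n \<Longrightarrow> (\<lambda>i\<in>{1..}. c) \<in> digit_seqs n"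
  by (auto simp: digit_seqs_def)

lemma prefix_value_const:
  "n > 0 \<Longrightarrow> prefix_value n N (\<lambda>i\<in>{1..}. n - 1) = n ^ N - 1"
proof (induction N)
  case (Suc N)
  then show ?case
    by (cases n) (auto simp: prefix_value_Suc)
qed simp

text \<open>Divisibility by \<open>n ^ k\<close> depends only on the first \<open>k\<close> digits.
  Their value is at most \<open>n ^ k - 1\<close>, so its successor is divisible only if it equals
  \<open>n ^ k\<close>, that is, if all these digits are \<open>n - 1\<close>.\<close>

lemma power_dvd_Suc_prefix_value:
  assumes "x \<in> digit_seqs n" "n \<ge> 2" "k \<le> N"
  shows "n ^ k dvd Suc (prefix_value n N x) \<longleftrightarrow> (\<forall>i\<in>{1..k}. x i = n - 1)"
proof -
  have "n ^ k dvd Suc (prefix_value n N x) \<longleftrightarrow> n ^ k dvd Suc (prefix_value n k x)"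
    using prefix_value_mod[of x n k N] assms
    by (metis dvd_eq_mod_eq_0 mod_Suc_eq not_gr_zero not_numeral_le_zero)
  also have "\<dots> \<longleftrightarrow> prefix_value n k x = n ^ k - 1"
  proof -
    have "Suc (prefix_value n k x) \<le> n ^ k"
      using prefix_value_less[of x n k] assms by simp
    then show ?thesis
      using assms by (auto dest: dvd_imp_le)
  qed
  also have "\<dots> \<longleftrightarrow> (\<forall>i\<in>{1..k}. x i = n - 1)"
    using prefix_value_eq_iff[of x n "\<lambda>i\<in>{1..}. n - 1" k] const_digit_seqs[of "n - 1" n]
      prefix_value_const[of n k] assms by simp
  finally show ?thesis .
qed

lemma carry_index_eq_enat_iff:
  "carry_index n x = enat k \<longleftrightarrow> 1 \<le> k \<and> x k \<noteq> n - 1 \<and> (\<forall>i\<in>{1..<k}. x i = n - 1)"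
proof (cases "\<exists>k\<ge>1. x k \<noteq> n - 1")
  case True
  define P where "P k \<longleftrightarrow> 1 \<le> k \<and> x k \<noteq> n - 1" for k
  have index: "carry_index n x = enat (Least P)"
    using True unfolding carry_index_def P_def by simp
  show ?thesis
  proof
    assume "carry_index n x = enat k"
    then have k: "k = Least P" using index by simp
    have "P k"
      unfolding k using True by (intro LeastI_ex[of P]) (simp add: P_def)
    moreover have "\<not> P i" if "i < k" for i
      using that unfolding k by (rule not_less_Least)
    ultimately show "1 \<le> k \<and> x k \<noteq> n - 1 \<and> (\<forall>i\<in>{1..<k}. x i = n - 1)"
      by (auto simp: P_def)
  next
    assume "1 \<le> k \<and> x k \<noteq> n - 1 \<and> (\<forall>i\<in>{1..<k}. x i = n - 1)"
    then have "Least P = k"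
      unfolding P_def by (intro Least_equality) (auto simp: not_less[symmetric] simp del: not_less)
    then show "carry_index n x = enat k"
      using index by simp
  qed
qed (auto simp: carry_index_def)

lemma carry_index_eq_infinity_iff: "carry_index n x = \<infinity> \<longleftrightarrow> (\<forall>i\<ge>1. x i = n - 1)"
  by (auto simp: carry_index_def)

text \<open>For \<open>w > 0\<close> and \<open>n \<ge> 2\<close> this is one more than the largest
  \<open>k\<close> with \<open>n ^ k dvd w\<close>: the position of the lowest nonzero
  base-\<open>n\<close> digit of \<open>w\<close>.\<close>

definition carry_level :: "nat \<Rightarrow> nat \<Rightarrow> nat" where
  "carry_level n w = (LEAST k. \<not> n ^ k dvd w)"

lemma not_power_dvd: "0 < w \<Longrightarrow> w < n ^ N \<Longrightarrow> \<not> n ^ N dvd (w :: nat)"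
  by (auto dest: dvd_imp_le)

lemma carry_level_eqI:
  assumes "n ^ k dvd w" "\<not> n ^ Suc k dvd w"
  shows "carry_level n w = Suc k"
  unfolding carry_level_def
proof (rule Least_equality)
  fix j assume "\<not> n ^ j dvd w"
  then have "\<not> j \<le> k"
    using assms(1) by (meson dvd_trans le_imp_power_dvd)
  then show "Suc k \<le> j" by simp
qed (use assms in simp)

lemma carry_level_bounds:
  assumes "0 < w" "w < n ^ N"
  shows "carry_level n w \<in> {1..N}"
proof -
  have "\<not> n ^ carry_level n w dvd w"
    unfolding carry_level_def by (rule LeastI) (rule not_power_dvd[OF assms])
  then have "carry_level n w \<noteq> 0" by (metis power_0 one_dvd)
  moreover have "carry_level n w \<le> N"
    unfolding carry_level_def by (rule Least_le) (rule not_power_dvd[OF assms])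
  ultimately show ?thesis by simp
qed

text \<open>The level of \<open>w\<close> is at most \<open>N\<close>, and \<open>a * n ^ N\<close>
  is divisible by every \<open>n ^ k\<close> with \<open>k \<le> N\<close>, so adding it does not
  change the relevant divisibilities.\<close>

lemma carry_level_add:
  assumes "0 < w" "w < n ^ N"
  shows "carry_level n (a * n ^ N + w) = carry_level n w"
proof -
  have dvd: "n ^ k dvd a * n ^ N + w \<longleftrightarrow> n ^ k dvd w" if "k \<le> N" for k
    using that by (intro dvd_add_right_iff dvd_mult le_imp_power_dvd)
  define k where "k = carry_level n w - 1"
  have k: "carry_level n w = Suc k" "Suc k \<le> N"
    using carry_level_bounds[OF assms] by (auto simp: k_def)
  have "\<not> n ^ Suc k dvd w"
    unfolding k(1)[symmetric] carry_level_def by (rule LeastI) (rule not_power_dvd[OF assms])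
  moreover have "n ^ k dvd w"
    using not_less_Least[of k "\<lambda>k. \<not> n ^ k dvd w"] k(1) by (simp add: carry_level_def)
  ultimately show ?thesis
    using dvd[of k] dvd[of "Suc k"] k by (intro trans[OF carry_level_eqI]) auto
qed

lemma carry_level_mult:
  assumes "0 < a" "a < n"
  shows "carry_level n (a * n ^ N) = Suc N"
proof (rule carry_level_eqI)
  show "\<not> n ^ Suc N dvd a * n ^ N"
    using assms not_power_dvd[of a n 1] by auto
qed simp

text \<open>Both sides are determined by the number of leading digits \<open>n - 1\<close>. The
  strict bound makes the carry stop within the first \<open>N\<close> digits, so that the prefix
  value alone decides which generator acts.\<close>

lemma carry_index_eq_carry_level:
  assumes x: "x \<in> digit_seqs n" "n \<ge> 2" and "Suc (prefix_value n N x) < n ^ N"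
  shows "carry_index n x = enat (carry_level n (Suc (prefix_value n N x)))"
proof -
  let ?w = "Suc (prefix_value n N x)"
  define k where "k = carry_level n ?w - 1"
  have k: "carry_level n ?w = Suc k" "Suc k \<le> N"
    using carry_level_bounds[OF _ assms(3)] by (auto simp: k_def)
  have "\<not> n ^ Suc k dvd ?w"
    unfolding k(1)[symmetric] carry_level_def
    by (rule LeastI) (rule not_power_dvd[OF _ assms(3)], simp)
  moreover have "n ^ k dvd ?w"
    using not_less_Least[of k "\<lambda>k. \<not> n ^ k dvd ?w"] k(1) by (simp add: carry_level_def)
  ultimately have "\<not> (\<forall>i\<in>{1..Suc k}. x i = n - 1)" "\<forall>i\<in>{1..k}. x i = n - 1"
    using power_dvd_Suc_prefix_value[OF x, of k N] power_dvd_Suc_prefix_value[OF x, of "Suc k" N] k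
    by auto
  then show ?thesis
    unfolding k carry_index_eq_enat_iff by (auto simp: atLeastAtMostSuc_conv)
qed

section \<open>The odometer on prefix values\<close>

lemma odometer_apply:
  assumes "carry_index n x = enat k" "i \<ge> 1"
  shows "odometer n x i = (if i < k then 0 else if i = k then x k + 1 else x i)"
  using assms by (auto simp: odometer_def)

lemma odometer_digit_seqs:
  assumes "x \<in> digit_seqs n" "n \<ge> 2"
  shows "odometer n x \<in> digit_seqs n"
proof (cases "carry_index n x")
  case (enat k)
  then have "x k \<noteq> n - 1" "1 \<le> k"
    by (auto simp: carry_index_eq_enat_iff)
  then have "x k + 1 < n"
    using digit_seqsD[OF assms(1), of k] by simp
  then have "odometer n x i < n" if "i \<ge> 1" for i
    using odometer_apply[OF enat that] digit_seqsD[OF assms(1) that] assms(2) by auto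
  then show ?thesis
    by (auto simp: digit_seqs_def odometer_def)
next
  case infinity
  then show ?thesis
    using assms by (auto simp: digit_seqs_def odometer_def)
qed

text \<open>If the carry passes position \<open>N\<close>, both sides are 0. Otherwise the values
  are compared at the carry position, and the higher digits do not change.\<close>

lemma prefix_value_odometer:
  assumes x: "x \<in> digit_seqs n" "n \<ge> 2"
  shows "prefix_value n N (odometer n x) = Suc (prefix_value n N x) mod n ^ N"
proof (cases "carry_index n x")
  case infinity
  then have "n ^ N dvd Suc (prefix_value n N x)"
    using power_dvd_Suc_prefix_value[OF x, of N N] by (simp add: carry_index_eq_infinity_iff)
  moreover have "prefix_value n N (odometer n x) = 0"
    using infinity by (simp add: prefix_value_def odometer_def)
  ultimately show ?thesis by simp
next
  case k: (enat k)
  note k' = k[unfolded carry_index_eq_enat_iff]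
  have zero: "prefix_value n M (odometer n x) = 0" if "M < k" for M
    using that by (auto simp: prefix_value_def odometer_apply[OF k])
  show ?thesis
  proof (cases "N < k")
    case True
    then have "n ^ N dvd Suc (prefix_value n N x)"
      using power_dvd_Suc_prefix_value[OF x, of N N] k' by auto
    then show ?thesis
      using zero[OF True] by simp
  next
    case False
    then have "k \<le> N" by simp
    then have "prefix_value n N (odometer n x) = Suc (prefix_value n N x)"
    proof (induction N rule: dec_induct)
      case base
      \<comment> \<open>Digits worth \<open>n ^ j - 1\<close> are reset to 0 and one
        \<open>n ^ j\<close> is added, a net gain of 1.\<close>
      obtain j where j: "k = Suc j" using k' by (cases k) auto
      have "prefix_value n j x = prefix_value n j (\<lambda>i\<in>{1..}. n - 1)"
        using k' j by (intro prefix_value_cong) auto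
      then have "Suc (prefix_value n j x) = n ^ j"
        using x(2) prefix_value_const[of n j] by simp
      moreover have "prefix_value n j (odometer n x) = 0"
        using zero[of j] j by simp
      ultimately show ?case
        using odometer_apply[OF k, of "Suc j"] by (simp add: j prefix_value_Suc)
    next
      case (step N)
      then show ?case
        using odometer_apply[OF k, of "Suc N"] by (simp add: prefix_value_Suc)
    qed
    moreover have "prefix_value n N (odometer n x) < n ^ N"
      using odometer_digit_seqs[OF x] x(2) by (intro prefix_value_less) auto
    ultimately show ?thesis by simp
  qed
qed

section \<open>The cocycle\<close>

text \<open>The fibre permutation accumulated in \<open>w\<close> steps of the skew product from a
  cell of prefix value 0 at a level \<open>N\<close> with \<open>w < n ^ N\<close>; the latest
  generator stands on the left, and \<open>g i\<close> plays the role of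
  \<open>\<psi> (free_gen i)\<close>.\<close>

fun cocycle :: "nat \<Rightarrow> (nat \<Rightarrow> 'a \<Rightarrow> 'a) \<Rightarrow> nat \<Rightarrow> 'a \<Rightarrow> 'a" where
  "cocycle n g 0 = id"
| "cocycle n g (Suc w) = g (carry_level n (Suc w)) \<circ> cocycle n g w"

lemma cocycle_cong:
  assumes "\<And>i. i \<in> {1..N} \<Longrightarrow> g i = g' i" "w < n ^ N"
  shows "cocycle n g w = cocycle n g' w"
  using assms(2)
proof (induction w)
  case (Suc w)
  then show ?case
    using assms(1)[OF carry_level_bounds[of "Suc w" n N]] by simp
qed simp

text \<open>By \<open>carry_level_add\<close> the carries after time \<open>a * n ^ N\<close> repeat
  those after time 0.\<close>

lemma cocycle_add:
  "w < n ^ N \<Longrightarrow> cocycle n g (a * n ^ N + w) = cocycle n g w \<circ> cocycle n g (a * n ^ N)"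
proof (induction w)
  case (Suc w)
  then show ?case
    using carry_level_add[of "Suc w" n N a] by (simp add: comp_assoc)
qed simp

text \<open>The step to time \<open>n ^ N\<close> is the first with carry level
  \<open>Suc N\<close>, so \<open>g (Suc N)\<close> enters here for the first time, as the leftmost
  factor.\<close>

lemma cocycle_power:
  assumes "n \<ge> 2"
  shows "cocycle n g (n ^ N) = g (Suc N) \<circ> cocycle n g (n ^ N - 1)"
proof -
  have *: "n ^ N = Suc (n ^ N - 1)"
    using assms by simp
  have "carry_level n (Suc (n ^ N - 1)) = Suc N"
    using carry_level_mult[of 1 n N] assms unfolding *[symmetric] by simp
  then have "cocycle n g (Suc (n ^ N - 1)) = g (Suc N) \<circ> cocycle n g (n ^ N - 1)"
    by (simp only: cocycle.simps)
  then show ?thesis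
    unfolding *[symmetric] .
qed

text \<open>Each stretch of \<open>n ^ N\<close> steps ends with a carry of level exactly
  \<open>Suc N\<close> as long as \<open>a < n\<close>, and therefore contributes the same
  permutation; at \<open>a = n\<close> the next generator would enter.\<close>

lemma cocycle_mult:
  assumes "n \<ge> 2" "a < n"
  shows "cocycle n g (a * n ^ N) = cocycle n g (n ^ N) ^^ a"
  using assms(2)
proof (induction a)
  case (Suc a)
  have *: "Suc a * n ^ N = Suc (a * n ^ N + (n ^ N - 1))"
    using assms by simp
  have "cocycle n g (Suc a * n ^ N) =
      g (carry_level n (Suc a * n ^ N)) \<circ> cocycle n g (a * n ^ N + (n ^ N - 1))"
    unfolding * by (rule cocycle.simps)
  also have "\<dots> = cocycle n g (n ^ N) \<circ> cocycle n g (a * n ^ N)"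
    using Suc.prems assms cocycle_add[of "n ^ N - 1" n N g a]
    by (simp only: carry_level_mult[of "Suc a"] cocycle_power) (simp add: comp_assoc del: One_nat_def)
  finally show ?case
    using Suc by simp
qed simp

section \<open>Contraction of oscillations\<close>

text \<open>Let \<open>q (N + k)\<close> have minimum \<open>lo\<close> and maximum
  \<open>lo + D\<close>, attained at \<open>j0\<close>. Unfolding the averages, \<open>q N m\<close>
  is a mean over paths from level \<open>N\<close> to \<open>N + k\<close>. One path of weight
  \<open>1 / n ^ k\<close> ends in \<open>j0\<close>: it stays at \<open>m\<close>, jumps to
  \<open>j0\<close> at the level given by \<open>hit\<close>, and stays there. Hence
  \<open>q N m\<close> is at least \<open>lo + D / n ^ k\<close>, while the upper bound
  \<open>lo + D\<close> persists.\<close>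

lemma averages_oscillation_contract:
  fixes q :: "nat \<Rightarrow> 'a \<Rightarrow> real" and s :: "nat \<Rightarrow> 'a \<Rightarrow> 'a"
  assumes S: "finite S" "S \<noteq> {}" and n: "n \<ge> 2"
    and s: "\<And>N m. m \<in> S \<Longrightarrow> s N m \<in> S"
    and avg: "\<And>N m. m \<in> S \<Longrightarrow> q N m = (\<Sum>a<n. q (Suc N) ((s N ^^ a) m)) / n"
    and hit: "\<And>i j. i \<in> S \<Longrightarrow> j \<in> S \<Longrightarrow> \<exists>r<k. s (N + r) i = j"
    and osc: "\<And>i j. i \<in> S \<Longrightarrow> j \<in> S \<Longrightarrow> q (N + k) i - q (N + k) j \<le> c"
    and ij: "i \<in> S" "j \<in> S"
  shows "q N i - q N j \<le> (1 - 1 / n ^ k) * c"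
proof -
  have sp: "(s M ^^ a) m \<in> S" if "m \<in> S" for M m a
    using that by (induction a) (auto intro: s)
  have sums: "(\<Sum>a<n. c) = n * c" for c :: real by simp
  have upper: "\<forall>m\<in>S. q (M - r) m \<le> b" if "\<forall>m\<in>S. q M m \<le> b" "r \<le> M" for M b r
    using that(2)
  proof (induction r)
    case (Suc r)
    have M: "M - r = Suc (M - Suc r)" using Suc by simp
    have "q (M - Suc r) m \<le> b" if m: "m \<in> S" for m
    proof -
      have "(\<Sum>a<n. q (M - r) ((s (M - Suc r) ^^ a) m)) \<le> (\<Sum>a<n. b)"
        using Suc sp[OF m] by (intro sum_mono) auto
      then have "(\<Sum>a<n. q (M - r) ((s (M - Suc r) ^^ a) m)) / n \<le> n * b / n"
        unfolding sums by (rule divide_right_mono) simp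
      then show ?thesis
        using n avg[OF m, of "M - Suc r", folded M] by simp
    qed
    then show ?case by blast
  qed (use that in auto)
  have fin: "finite (q (N + k) ` S)" "q (N + k) ` S \<noteq> {}"
    using S by auto
  obtain i0 where "i0 \<in> S" "q (N + k) i0 = Min (q (N + k) ` S)"
    using Min_in[OF fin] by auto
  then have i0: "i0 \<in> S" "\<And>m. m \<in> S \<Longrightarrow> q (N + k) i0 \<le> q (N + k) m"
    using Min_le[OF fin(1)] by auto
  obtain j0 where "j0 \<in> S" "q (N + k) j0 = Max (q (N + k) ` S)"
    using Max_in[OF fin] by auto
  then have j0: "j0 \<in> S" "\<And>m. m \<in> S \<Longrightarrow> q (N + k) m \<le> q (N + k) j0"
    using Max_ge[OF fin(1)] by auto
  define lo where "lo = q (N + k) i0"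
  define D where "D = q (N + k) j0 - lo"
  have D: "0 \<le> D" "D \<le> c"
    using i0 j0 osc[OF j0(1) i0(1)] by (auto simp: D_def lo_def)
  \<comment> \<open>A mean of nonnegative terms is at least each term divided by \<open>n\<close>.
    The terms \<open>a = 0\<close> and \<open>a = 1\<close> allow staying at \<open>m\<close> or
    moving to \<open>s M m\<close>; both exist because \<open>n \<ge> 2\<close>.\<close>
  have one: "q M m - lo \<ge> (q (Suc M) m' - lo) / n"
    if m: "m \<in> S" and M: "\<forall>m\<in>S. lo \<le> q (Suc M) m" and m': "m' \<in> {m, s M m}" for M m m'
  proof -
    obtain b where b: "b < n" "m' = (s M ^^ b) m"
      using m' n by (auto intro: that[of 0] that[of 1])
    have "q (Suc M) m' - lo \<le> (\<Sum>a<n. q (Suc M) ((s M ^^ a) m) - lo)"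
      unfolding b(2) using b(1) M sp[OF m]
      by (intro member_le_sum[of b "{..<n}" "\<lambda>a. q (Suc M) ((s M ^^ a) m) - lo"]) auto
    also have "\<dots> = n * (q M m - lo)"
      using n by (simp add: sum_subtractf avg[OF m, of M] right_diff_distrib)
    finally have "(q (Suc M) m' - lo) / n \<le> n * (q M m - lo) / n"
      by (rule divide_right_mono) simp
    then show ?thesis
      using n by simp
  qed
  have "\<forall>m\<in>S. lo \<le> q (N + k - r) m" if "r \<le> k" for r
    using that
  proof (induction r)
    case 0
    then show ?case using i0 by (auto simp: lo_def)
  next
    case (Suc r)
    have M: "N + k - r = Suc (N + k - Suc r)" using Suc by simp
    show ?case
    proof
      fix m assume m: "m \<in> S"
      have "0 \<le> (q (Suc (N + k - Suc r)) m - lo) / n"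
        using Suc m n unfolding M[symmetric] by simp
      also have "\<dots> \<le> q (N + k - Suc r) m - lo"
        using Suc unfolding M by (intro one[OF m]) auto
      finally show "lo \<le> q (N + k - Suc r) m" by simp
    qed
  qed
  then have lower: "\<forall>m\<in>S. lo \<le> q (N + r) m" if "r \<le> k" for r
    using that by (metis diff_diff_cancel diff_le_self Nat.diff_add_assoc)
  have descend: "D / n ^ (k - r) \<le> q (N + r) m - lo"
    if "r < k" "m \<in> S" "m' \<in> {m, s (N + r) m}" "D / n ^ (k - Suc r) \<le> q (N + Suc r) m' - lo" for r m m'
  proof -
    have "D / n ^ (k - r) = D / n ^ (k - Suc r) / n"
      using that(1) by (simp add: Suc_diff_Suc[symmetric])
    also have "\<dots> \<le> (q (N + Suc r) m' - lo) / n"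
      using that(4) n by (intro divide_right_mono) auto
    also have "\<dots> \<le> q (N + r) m - lo"
      using lower[of "Suc r"] one[OF that(2), of "N + r" m'] that by simp
    finally show ?thesis .
  qed
  have down: "D / n ^ (k - r0) \<le> q (N + r0) m - lo"
    if "r0 \<le> r" "r \<le> k" "m \<in> S" "D / n ^ (k - r) \<le> q (N + r) m - lo" for r0 r m
    using that(1)
  proof (induction r0 rule: inc_induct)
    case (step i)
    then show ?case
      using that by (intro descend[of i m m]) auto
  qed (rule that)
  \<comment> \<open>The path is followed from the top: stay at \<open>j0\<close> down to level
    \<open>N + Suc r\<close>, move to \<open>m\<close> at level \<open>N + r\<close>, stay at
    \<open>m\<close> down to level \<open>N\<close>.\<close>
  have "D / n ^ k \<le> q N m - lo" if m: "m \<in> S" for m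
  proof -
    obtain r where r: "r < k" "s (N + r) m = j0"
      using hit[OF m j0(1)] by blast
    have "D / n ^ (k - Suc r) \<le> q (N + Suc r) j0 - lo"
      using r by (intro down[of "Suc r" k]) (auto simp: D_def j0)
    then have "D / n ^ (k - r) \<le> q (N + r) m - lo"
      using r by (intro descend[OF r(1) m, of j0]) auto
    then show ?thesis
      using down[of 0 r m] r m by simp
  qed
  then have "D / n ^ k \<le> q N j - lo" using ij by blast
  moreover have "q N i \<le> lo + D"
    using upper[of "N + k" "lo + D" k] j0 ij by (simp add: D_def)
  ultimately have "q N i - q N j \<le> (1 - 1 / n ^ k) * D"
    by (simp add: algebra_simps)
  also have "\<dots> \<le> (1 - 1 / n ^ k) * c"
    using D n by (intro mult_left_mono) auto
  finally show ?thesis by simp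
qed

text \<open>Oscillation cannot grow when the level decreases, and each good block multiplies it by
  at most \<open>1 - 1 / n ^ k\<close>. Above any level there are arbitrarily many disjoint good
  blocks, and the bound by 1 at all levels starts the estimate.\<close>

lemma averages_constant:
  fixes q :: "nat \<Rightarrow> 'a \<Rightarrow> real" and s :: "nat \<Rightarrow> 'a \<Rightarrow> 'a"
  assumes S: "finite S" "S \<noteq> {}" and n: "n \<ge> 2"
    and s: "\<And>N m. m \<in> S \<Longrightarrow> s N m \<in> S"
    and avg: "\<And>N m. m \<in> S \<Longrightarrow> q N m = (\<Sum>a<n. q (Suc N) ((s N ^^ a) m)) / n"
    and hit: "\<And>N0. \<exists>N\<ge>N0. \<forall>i\<in>S. \<forall>j\<in>S. \<exists>r<k. s (N + r) i = j"
    and bound: "\<And>N i. i \<in> S \<Longrightarrow> q N i \<in> {0..1}"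
    and ij: "i \<in> S" "j \<in> S"
  shows "q N i = q N j"
proof -
  let ?\<delta> = "1 - 1 / real n ^ k"
  have \<delta>: "0 \<le> ?\<delta>" "?\<delta> < 1"
    using n by auto
  have mono: "\<forall>i\<in>S. \<forall>j\<in>S. q N i - q N j \<le> c"
    if "\<forall>i\<in>S. \<forall>j\<in>S. q (N + r) i - q (N + r) j \<le> c" for N r c
    using that
  proof (induction r arbitrary: N)
    case (Suc r)
    show ?case
    proof (intro ballI)
      fix i j assume ij: "i \<in> S" "j \<in> S"
      have sp: "(s N ^^ a) m \<in> S" if "m \<in> S" for m a
        using that by (induction a) (auto intro: s)
      have "\<forall>i\<in>S. \<forall>j\<in>S. q (Suc N) i - q (Suc N) j \<le> c"
        using Suc.prems by - (rule Suc.IH[of "Suc N"], simp only: add_Suc_shift)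
      then have "(\<Sum>a<n. q (Suc N) ((s N ^^ a) i) - q (Suc N) ((s N ^^ a) j)) \<le> (\<Sum>a<n. c)"
        using sp[OF ij(1)] sp[OF ij(2)] by (intro sum_mono) blast
      then have "(\<Sum>a<n. q (Suc N) ((s N ^^ a) i)) - (\<Sum>a<n. q (Suc N) ((s N ^^ a) j)) \<le> n * c"
        by (simp add: sum_subtractf)
      then show "q N i - q N j \<le> c"
        using n avg[OF ij(1), of N] avg[OF ij(2), of N]
        by (simp add: diff_divide_distrib[symmetric] pos_divide_le_eq mult.commute)
    qed
  qed simp
  have osc: "\<forall>i\<in>S. \<forall>j\<in>S. q N i - q N j \<le> ?\<delta> ^ J" for J N
  proof (induction J arbitrary: N)
    case 0
    show ?case
    proof (intro ballI)
      fix i j assume "i \<in> S" "j \<in> S"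
      then show "q N i - q N j \<le> ?\<delta> ^ 0"
        using bound[of i N] bound[of j N] by simp
    qed
  next
    case (Suc J)
    obtain M where M: "M \<ge> N" "\<And>i j. i \<in> S \<Longrightarrow> j \<in> S \<Longrightarrow> \<exists>r<k. s (M + r) i = j"
      using hit[of N] by blast
    \<comment> \<open>The induction hypothesis is applied above the block, at level
      \<open>M + k\<close>; this is why it quantifies over all levels.\<close>
    have "\<forall>i\<in>S. \<forall>j\<in>S. q M i - q M j \<le> ?\<delta> ^ Suc J"
      using averages_oscillation_contract[OF S n s avg M(2), where c = "?\<delta> ^ J"] Suc.IH[of "M + k"]
      by simp
    then show ?case
      using mono[of N "M - N" "?\<delta> ^ Suc J"] M(1) by simp
  qed
  have lim: "(\<lambda>J. ?\<delta> ^ J) \<longlonglongrightarrow> 0"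
    using \<delta> by (intro LIMSEQ_power_zero) auto
  have "q N i - q N j \<le> 0" if "i \<in> S" "j \<in> S" for i j
    using that osc[of N] by (intro tendsto_lowerbound[OF lim]) auto
  from this[OF ij] this[OF ij(2) ij(1)] show ?thesis by simp
qed

section \<open>Random blocks\<close>

text \<open>Independence is used only in the form that all initial words of a given length are
  equally likely, so probabilities become counts. Testing just the disjoint blocks that start at
  \<open>N0 + J * k\<close>, the chance of missing \<open>L\<close> in the first \<open>J\<close> of
  them is \<open>(1 - 1 / card A ^ k) ^ J\<close>, which tends to 0.\<close>

lemma (in prob_space) AE_block_occurs:
  fixes X :: "nat \<Rightarrow> 'a \<Rightarrow> 'b"
  assumes A: "finite A"
    and X: "\<And>i \<omega>. \<omega> \<in> space M \<Longrightarrow> X i \<omega> \<in> A"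
    and events: "\<And>xs. set xs \<subseteq> A \<Longrightarrow>
      {\<omega> \<in> space M. map (\<lambda>i. X i \<omega>) [0..<length xs] = xs} \<in> events"
    and uniform: "\<And>xs. set xs \<subseteq> A \<Longrightarrow>
      prob {\<omega> \<in> space M. map (\<lambda>i. X i \<omega>) [0..<length xs] = xs} = (1 / card A) ^ length xs"
    and L: "set L \<subseteq> A"
  shows "AE \<omega> in M. \<exists>N\<ge>N0. \<forall>r<length L. X (N + r) \<omega> = L ! r"
proof -
  define k where "k = length L"
  define W where "W N = {xs. set xs \<subseteq> A \<and> length xs = N}" for N
  have W: "finite (W N)" "card (W N) = card A ^ N" for N
    unfolding W_def using A by (auto intro: finite_lists_length_eq card_lists_length_eq)
  have "A \<noteq> {}"
    using X not_empty by blast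
  then have c: "card A > 0"
    using A by (simp add: card_gt_0_iff)
  define word where "word \<omega> N = map (\<lambda>i. X i \<omega>) [0..<N]" for \<omega> N
  define E where "E N S = {\<omega> \<in> space M. word \<omega> N \<in> S}" for N S
  have E: "E N S \<in> events" "prob (E N S) = card S / card A ^ N" if "S \<subseteq> W N" for N S
  proof -
    have S: "finite S" using that W(1) finite_subset by blast
    have eq: "E N S = (\<Union>xs\<in>S. {\<omega> \<in> space M. map (\<lambda>i. X i \<omega>) [0..<length xs] = xs})"
      using that by (auto simp: E_def word_def W_def)
    have S_A: "set xs \<subseteq> A" "length xs = N" if "xs \<in> S" for xs
      using that \<open>S \<subseteq> W N\<close> by (auto simp: W_def)
    show "E N S \<in> events"
      unfolding eq using S events[OF S_A(1)] by (rule sets.finite_UN)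
    have "prob (E N S) =
        (\<Sum>xs\<in>S. prob {\<omega> \<in> space M. map (\<lambda>i. X i \<omega>) [0..<length xs] = xs})"
      unfolding eq
    proof (rule finite_measure_finite_Union[OF S])
      show "(\<lambda>xs. {\<omega> \<in> space M. map (\<lambda>i. X i \<omega>) [0..<length xs] = xs}) ` S \<subseteq> events"
        using events[OF S_A(1)] by blast
      show "disjoint_family_on (\<lambda>xs. {\<omega> \<in> space M. map (\<lambda>i. X i \<omega>) [0..<length xs] = xs}) S"
        using S_A(2) by (force simp: disjoint_family_on_def)
    qed
    also have "\<dots> = (\<Sum>xs\<in>S. (1 / card A) ^ N)"
      using S_A uniform by (intro sum.cong refl) metis
    finally show "prob (E N S) = card S / card A ^ N"
      by (simp add: power_one_over)
  qed
  \<comment> \<open>Words of length \<open>N0 + J * k\<close> whose first \<open>N0\<close> letters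
    are free and whose \<open>J\<close> subsequent blocks all differ from \<open>L\<close>.\<close>
  define Bad where "Bad = rec_nat (W N0) (\<lambda>_ B. (\<lambda>(xs, ys). xs @ ys) ` (B \<times> (W k - {L})))"
  have Bad_simps: "Bad 0 = W N0"
    "Bad (Suc J) = (\<lambda>(xs, ys). xs @ ys) ` (Bad J \<times> (W k - {L}))" for J
    by (simp_all add: Bad_def)
  have Bad: "Bad J \<subseteq> W (N0 + J * k)" for J
  proof (induction J)
    case (Suc J)
    then show ?case
      unfolding Bad_simps by (fastforce simp: W_def)
  qed (simp add: Bad_simps)
  have card_Bad: "card (Bad J) = card A ^ N0 * (card A ^ k - 1) ^ J" for J
  proof (induction J)
    case (Suc J)
    have "inj_on (\<lambda>(xs, ys). xs @ ys) (Bad J \<times> (W k - {L}))"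
      using Bad[of J] by (auto simp: inj_on_def W_def subset_iff)
    then have "card (Bad (Suc J)) = card (Bad J) * card (W k - {L})"
      unfolding Bad_simps by (simp add: card_image card_cartesian_product)
    also have "card (W k - {L}) = card A ^ k - 1"
      using L W by (simp add: card_Diff_singleton W_def k_def)
    finally show ?case
      using Suc by simp
  qed (simp add: Bad_simps W)
  have missed: "word \<omega> (N0 + J * k) \<in> Bad J"
    if \<omega>: "\<omega> \<in> space M" "\<not> (\<exists>N\<ge>N0. \<forall>r<length L. X (N + r) \<omega> = L ! r)" for \<omega> J
  proof (induction J)
    case 0
    show ?case using X[OF \<omega>(1)] by (auto simp: Bad_simps W_def word_def)
  next
    case (Suc J)
    let ?ys = "map (\<lambda>i. X i \<omega>) [N0 + J * k..<N0 + J * k + k]"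
    have "word \<omega> (N0 + Suc J * k) = word \<omega> (N0 + J * k) @ ?ys"
      unfolding word_def map_append[symmetric] upt_add_eq_append[OF le0, symmetric] by (simp add: ac_simps)
    moreover have "?ys \<noteq> L"
    proof
      assume ys: "?ys = L"
      have "X (N0 + J * k + r) \<omega> = L ! r" if "r < length L" for r
      proof -
        have "?ys ! r = X (N0 + J * k + r) \<omega>"
          using that by (simp add: k_def)
        then show ?thesis by (simp only: ys)
      qed
      then show False
        using \<omega>(2) by (metis le_add1)
    qed
    moreover have "?ys \<in> W k"
      using X[OF \<omega>(1)] by (auto simp: W_def)
    ultimately show ?case
      using Suc unfolding Bad_simps by auto
  qed
  \<comment> \<open>A measurable null set that covers the exceptional set.\<close>
  define Z where "Z = (\<Inter>J. E (N0 + J * k) (Bad J))"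
  let ?r = "1 - 1 / real (card A ^ k)"
  have r: "0 \<le> ?r" "?r < 1"
    using c by (auto simp: Suc_leI)
  have "prob Z \<le> ?r ^ J" for J
  proof -
    have "prob Z \<le> prob (E (N0 + J * k) (Bad J))"
      using E(1)[OF Bad] by (intro finite_measure_mono) (auto simp: Z_def)
    also have "\<dots> = card A ^ N0 * (card A ^ k - 1) ^ J / card A ^ (N0 + J * k)"
      unfolding E(2)[OF Bad] card_Bad by simp
    also have "\<dots> = ((card A ^ k - 1) / card A ^ k) ^ J"
      using c by (simp add: power_add power_divide power_mult[symmetric] mult.commute of_nat_diff Suc_leI)
    also have "(card A ^ k - 1) / card A ^ k = ?r"
      using c by (simp add: diff_divide_distrib)
    finally show ?thesis .
  qed
  moreover have "(\<lambda>J. ?r ^ J) \<longlonglongrightarrow> 0"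
    using r by (intro LIMSEQ_power_zero) auto
  ultimately have "prob Z \<le> 0"
    by (intro tendsto_lowerbound[of "\<lambda>J. ?r ^ J" 0 sequentially]) auto
  then have "prob Z = 0"
    by (simp add: measure_le_0_iff)
  moreover have Z: "Z \<in> events"
    unfolding Z_def using E(1)[OF Bad] by (intro sets.countable_INT) auto
  ultimately have "emeasure M Z = 0"
    by (simp add: emeasure_eq_measure)
  moreover have "{\<omega> \<in> space M. \<not> (\<exists>N\<ge>N0. \<forall>r<length L. X (N + r) \<omega> = L ! r)} \<subseteq> Z"
    using missed by (auto simp: Z_def E_def)
  ultimately show ?thesis
    using Z by (intro AE_I[of _ _ Z]) auto
qed

section \<open>Cocycles with values in a permutation group\<close>

lemma perm_subgroupD:
  assumes "subgroup G (sym_group d)"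
  shows "g \<in> G \<Longrightarrow> g permutes {1..d}"
    and "g \<in> G \<Longrightarrow> h \<in> G \<Longrightarrow> g \<circ> h \<in> G"
    and "g \<in> G \<Longrightarrow> Hilbert_Choice.inv g \<in> G"
    and "id \<in> G"
proof -
  interpret subgroup G "sym_group d" by fact
  show perm: "g permutes {1..d}" if "g \<in> G" for g
    using subset that by (auto simp: sym_group_def)
  show "g \<circ> h \<in> G" if "g \<in> G" "h \<in> G"
    using m_closed[OF that] by (simp add: sym_group_def)
  show "Hilbert_Choice.inv g \<in> G" if "g \<in> G"
    using m_inv_closed[OF that] sym_group_inv_equality[of g d] perm[OF that]
    by (simp add: sym_group_def)
  show "id \<in> G"
    using one_closed by (simp add: sym_group_def id_def)
qed

lemma cocycle_in_subgroup:
  assumes G: "subgroup G (sym_group d)" and n: "n \<ge> 2" and g: "\<And>i. i \<ge> 1 \<Longrightarrow> g i \<in> G"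
  shows "cocycle n g w \<in> G"
proof (induction w)
  case 0
  show ?case unfolding cocycle.simps by (rule perm_subgroupD(4)[OF G])
next
  case (Suc w)
  \<comment> \<open>Any level above \<open>w\<close> serves here; it only has to make the carry
    level at least 1, where \<open>g\<close> takes values in \<open>G\<close>.\<close>
  have "Suc w < n ^ Suc w"
    using n by (intro power_gt_expt) simp
  then have "g (carry_level n (Suc w)) \<in> G"
    using carry_level_bounds[of "Suc w" n "Suc w"] by (intro g) simp
  then show ?case
    using Suc unfolding cocycle.simps by (intro perm_subgroupD(2)[OF G])
qed

text \<open>
  The value at \<open>n ^ N\<close> is the fresh generator \<open>g (Suc N)\<close> composed with an element that depends
  only on \<open>g 1, \<dots>, g N\<close>, so prescribing the values at \<open>1, n, n\<^sup>2, \<dots>\<close> is the same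
  as prescribing the generators.
\<close>

lemma ex_generators_cocycle_eq:
  assumes G: "subgroup G (sym_group d)" and n: "n \<ge> 2" and "set xs \<subseteq> G"
  shows "\<exists>\<tau>. (\<forall>i. \<tau> i \<in> G) \<and> (\<forall>g. (\<forall>i\<ge>1. g i \<in> G) \<longrightarrow>
    (\<forall>i<length xs. cocycle n g (n ^ i) = xs ! i) = (\<forall>i\<in>{1..length xs}. g i = \<tau> i))"
  using assms(3)
proof (induction xs rule: rev_induct)
  case Nil
  then show ?case
    using perm_subgroupD(4)[OF G] by (intro exI[of _ "\<lambda>_. id"]) (simp add: id_def)
next
  case (snoc x xs)
  let ?N = "length xs"
  obtain \<tau> where \<tau>: "\<And>i. \<tau> i \<in> G" "\<And>g. \<forall>i\<ge>1. g i \<in> G \<Longrightarrow>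
      (\<forall>i<?N. cocycle n g (n ^ i) = xs ! i) = (\<forall>i\<in>{1..?N}. g i = \<tau> i)"
    using snoc by auto
  define c where "c = cocycle n \<tau> (n ^ ?N - 1)"
  have c: "c \<in> G"
    unfolding c_def by (rule cocycle_in_subgroup[OF G n \<tau>(1)])
  \<comment> \<open>Once the first \<open>?N\<close> generators are prescribed, the cocycle at
    \<open>n ^ ?N - 1\<close> is \<open>c\<close>, so the value \<open>x\<close> at
    \<open>n ^ ?N\<close> forces the next generator.\<close>
  define \<tau>' where "\<tau>' = \<tau>(Suc ?N := x \<circ> Hilbert_Choice.inv c)"
  have \<tau>': "\<tau>' i \<in> G" for i
    using c snoc.prems \<tau>(1)
    by (cases "i = Suc ?N") (auto simp: \<tau>'_def simp del: o_apply intro!: perm_subgroupD[OF G])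
  have bij: "bij c"
    using perm_subgroupD(1)[OF G c] by (rule permutes_bij)
  have solve: "a \<circ> c = x \<longleftrightarrow> a = x \<circ> Hilbert_Choice.inv c" for a
    using bij by (metis bij_is_inj bij_is_surj comp_assoc comp_id inv_o_cancel surj_iff)
  have "(\<forall>i<length (xs @ [x]). cocycle n g (n ^ i) = (xs @ [x]) ! i) =
      (\<forall>i\<in>{1..length (xs @ [x])}. g i = \<tau>' i)" if g: "\<forall>i\<ge>1. g i \<in> G" for g
  proof -
    have "(\<forall>i<length (xs @ [x]). cocycle n g (n ^ i) = (xs @ [x]) ! i) \<longleftrightarrow>
        (\<forall>i<?N. cocycle n g (n ^ i) = xs ! i) \<and> cocycle n g (n ^ ?N) = x"
      by (auto simp: less_Suc_eq nth_append)
    also have "\<dots> \<longleftrightarrow> (\<forall>i\<in>{1..?N}. g i = \<tau> i) \<and> g (Suc ?N) \<circ> cocycle n g (n ^ ?N - 1) = x"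
      using \<tau>(2)[OF g] cocycle_power[OF n, of g ?N] by simp
    also have "\<dots> \<longleftrightarrow> (\<forall>i\<in>{1..?N}. g i = \<tau> i) \<and> g (Suc ?N) \<circ> c = x"
      using cocycle_cong[of ?N g \<tau> "n ^ ?N - 1" n] n by (auto simp: c_def)
    also have "\<dots> \<longleftrightarrow> (\<forall>i\<in>{1..length (xs @ [x])}. g i = \<tau>' i)"
      unfolding solve by (auto simp: \<tau>'_def atLeastAtMostSuc_conv)
    finally show ?thesis .
  qed
  then show ?case
    using \<tau>' by (intro exI[of _ \<tau>']) blast
qed

lemma Hom_plus_generator: "\<psi> \<in> Hom_plus d G \<Longrightarrow> i \<ge> 1 \<Longrightarrow> \<psi> (free_gen i) \<in> G"
  by (auto simp: Hom_plus_def hom_def Gamma_plus_def free_gen_in_free_group)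

text \<open>Prescribing the first cocycle values at powers of \<open>n\<close> is a cylinder
  condition on equally many generators, so these values form uniform words as
  \<open>AE_block_occurs\<close> requires. The quantifier over \<open>N0\<close> is
  countable.\<close>

lemma AE_cocycle_block_occurs:
  assumes G: "subgroup G (sym_group d)" and n: "n \<ge> 2" and L: "set L \<subseteq> G"
  shows "AE \<psi> in mu_plus d G. \<forall>N0. \<exists>N\<ge>N0. \<forall>r<length L.
    cocycle n (\<lambda>i. \<psi> (free_gen i)) (n ^ (N + r)) = L ! r"
proof -
  interpret prob_space "mu_plus d G"
    by (rule prob_space_mu_plus[OF G])
  let ?X = "\<lambda>i \<psi>. cocycle n (\<lambda>i. \<psi> (free_gen i)) (n ^ i)"
  have block: "{\<psi> \<in> space (mu_plus d G). map (\<lambda>i. ?X i \<psi>) [0..<length xs] = xs} \<in> events \<and>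
      prob {\<psi> \<in> space (mu_plus d G). map (\<lambda>i. ?X i \<psi>) [0..<length xs] = xs} =
        (1 / card G) ^ length xs"
    if xs: "set xs \<subseteq> G" for xs
  proof -
    obtain \<tau> where \<tau>: "\<And>i. \<tau> i \<in> G" "\<And>g. \<forall>i\<ge>1. g i \<in> G \<Longrightarrow>
        (\<forall>i<length xs. cocycle n g (n ^ i) = xs ! i) = (\<forall>i\<in>{1..length xs}. g i = \<tau> i)"
      using ex_generators_cocycle_eq[OF G n xs] by blast
    have "{\<psi> \<in> space (mu_plus d G). map (\<lambda>i. ?X i \<psi>) [0..<length xs] = xs} =
        {\<psi> \<in> Hom_plus d G. \<forall>i\<in>{1..length xs}. \<psi> (free_gen i) = \<tau> i}"
    proof -
      have "map (\<lambda>i. ?X i \<psi>) [0..<length xs] = xs \<longleftrightarrow> (\<forall>i\<in>{1..length xs}. \<psi> (free_gen i) = \<tau> i)"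
        if "\<psi> \<in> Hom_plus d G" for \<psi>
      proof -
        have "map (\<lambda>i. ?X i \<psi>) [0..<length xs] = xs \<longleftrightarrow> (\<forall>i<length xs. ?X i \<psi> = xs ! i)"
          unfolding list_eq_iff_nth_eq by simp
        also have "\<dots> \<longleftrightarrow> (\<forall>i\<in>{1..length xs}. \<psi> (free_gen i) = \<tau> i)"
          by (rule \<tau>(2)) (use Hom_plus_generator[OF that] in blast)
        finally show ?thesis .
      qed
      then show ?thesis
        unfolding space_mu_plus by blast
    qed
    then show ?thesis
      using emeasure_mu_plus_cylinder[OF G, of "{1..length xs}" \<tau>] \<tau>(1)
      by (simp add: measure_def)
  qed
  show ?thesis
    unfolding AE_all_countable
  proof
    fix N0
    show "AE \<psi> in mu_plus d G. \<exists>N\<ge>N0. \<forall>r<length L. ?X (N + r) \<psi> = L ! r"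
    proof (rule AE_block_occurs[of G ?X])
      fix i \<psi> assume "\<psi> \<in> space (mu_plus d G)"
      then show "?X i \<psi> \<in> G"
        by (intro cocycle_in_subgroup[OF G n] Hom_plus_generator) auto
    qed (use block subgroup_sym_group_finite(1)[OF G] L in blast)+
  qed
qed

section \<open>Cells of the skew space\<close>

text \<open>Cylinder sets, indexed by a number instead of a digit word so that the dynamics becomes
  \<open>w + 1\<close>. Indices \<open>w \<ge> n ^ N\<close> give the empty set when
  \<open>n > 0\<close>.\<close>

definition cell :: "nat \<Rightarrow> nat \<Rightarrow> nat \<Rightarrow> nat \<Rightarrow> nat \<Rightarrow> ((nat \<Rightarrow> nat) \<times> nat) set" where
  "cell n d N w m = {p \<in> digit_seqs n \<times> {1..d}. prefix_value n N (fst p) = w \<and> snd p = m}"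

lemma space_skew_space [simp]: "space (skew_space n d) = digit_seqs n \<times> {1..d}"
  by (simp add: skew_space_def space_restrict_space)

lemma cell_eq_digits:
  assumes "e \<in> digit_seqs n" "n > 0"
  shows "cell n d N (prefix_value n N e) m =
    {p \<in> digit_seqs n \<times> {1..d}. (\<forall>i\<in>{1..N}. fst p i = e i) \<and> snd p = m}"
  using assms by (auto simp: cell_def prefix_value_eq_iff)

lemma cell_empty: "n > 0 \<Longrightarrow> n ^ N \<le> w \<Longrightarrow> cell n d N w m = {}"
  by (auto simp: cell_def dest!: leD intro: prefix_value_less)

section \<open>Cells generate the Borel sets and determine measures\<close>

lemma measurable_skew_digit: "(\<lambda>p. fst p i) \<in> skew_space n d \<rightarrow>\<^sub>M count_space UNIV"
proof -
  have "(\<lambda>p :: (nat \<Rightarrow> nat) \<times> nat. fst p i) \<in> borel_measurable borel"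
    by (rule borel_measurable_continuous_onI, rule continuous_on_product_then_coordinatewise,
      rule continuous_on_fst[OF continuous_on_id])
  then show ?thesis
    unfolding skew_space_def measurable_cong_sets[OF refl sets_borel_eq_count_space]
    by (rule measurable_restrict_space1)
qed

lemma measurable_skew_snd: "snd \<in> skew_space n d \<rightarrow>\<^sub>M count_space UNIV"
proof -
  have "(snd :: (nat \<Rightarrow> nat) \<times> nat \<Rightarrow> nat) \<in> borel_measurable borel"
    by (rule borel_measurable_continuous_onI, rule continuous_on_snd[OF continuous_on_id])
  then show ?thesis
    unfolding skew_space_def measurable_cong_sets[OF refl sets_borel_eq_count_space]
    by (rule measurable_restrict_space1)
qed

lemma cell_sets:
  assumes "n > 0"
  shows "cell n d N w m \<in> sets (skew_space n d)"
proof (cases "w < n ^ N")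
  case True
  then obtain e where e: "e \<in> digit_seqs n" "prefix_value n N e = w"
    using ex_prefix_value assms by blast
  note [measurable] = measurable_skew_digit measurable_skew_snd
  have "{p \<in> space (skew_space n d). (\<forall>i\<in>{1..N}. fst p i = e i) \<and> snd p = m} \<in> sets (skew_space n d)"
    by measurable
  then show ?thesis
    using cell_eq_digits[OF e(1) assms, of d N m] by (simp add: e(2))
qed (simp add: cell_empty assms)

text \<open>For the inclusion of the Borel sets, the identity is shown to be Borel measurable on the
  sigma-algebra of the cells. This is checked coordinatewise: a digit is a quotient of a prefix
  value.\<close>

lemma sets_skew_space:
  assumes n: "n > 0"
  shows "sets (skew_space n d) =
    sigma_sets (digit_seqs n \<times> {1..d}) {cell n d N w m | N w m. True}"
proof
  let ?\<Omega> = "digit_seqs n \<times> {1..d}" and ?E = "{cell n d N w m | N w m. True}"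
  define S where "S = sigma ?\<Omega> ?E"
  have E: "?E \<subseteq> Pow ?\<Omega>"
    by (auto simp: cell_def)
  have S: "space S = ?\<Omega>" "sets S = sigma_sets ?\<Omega> ?E"
    unfolding S_def using E by simp_all
  have cell_S: "cell n d N w m \<in> sets S" for N w m
    unfolding S by (intro sigma_sets.Basic) blast
  have prefix: "(\<lambda>p. prefix_value n N (fst p)) \<in> S \<rightarrow>\<^sub>M count_space UNIV" for N
    unfolding measurable_count_space_eq2_countable
  proof (intro conjI ballI)
    fix w
    have "(\<lambda>p. prefix_value n N (fst p)) -` {w} \<inter> space S = (\<Union>m\<in>{1..d}. cell n d N w m)"
      by (auto simp: S cell_def)
    then show "(\<lambda>p. prefix_value n N (fst p)) -` {w} \<inter> space S \<in> sets S"
      using cell_S by auto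
  qed simp
  have digit: "(\<lambda>p. fst p i) \<in> S \<rightarrow>\<^sub>M count_space UNIV" for i
  proof (cases i)
    case 0
    \<comment> \<open>Coordinate 0 is not a digit; extensionality makes it constant.\<close>
    have "(\<lambda>p. undefined) \<in> S \<rightarrow>\<^sub>M count_space UNIV" by simp
    then show ?thesis
      by (rule subst[OF measurable_cong, rotated]) (auto simp: S 0 digit_seqs_def)
  next
    case (Suc j)
    have "(\<lambda>p. prefix_value n (Suc j) (fst p) div n ^ j) \<in> S \<rightarrow>\<^sub>M count_space UNIV"
      using measurable_compose[OF prefix measurable_count_space] .
    moreover have "fst p i = prefix_value n (Suc j) (fst p) div n ^ j" if "p \<in> space S" for p
      using prefix_value_less[of "fst p" n j] that n by (auto simp: S Suc prefix_value_Suc)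
    ultimately show ?thesis
      by (simp cong: measurable_cong)
  qed
  have snd: "snd \<in> S \<rightarrow>\<^sub>M count_space UNIV"
    unfolding measurable_count_space_eq2_countable
  proof (intro conjI ballI)
    fix m
    have "snd -` {m} \<inter> space S = cell n d 0 0 m"
      by (auto simp: S cell_def)
    then show "snd -` {m} \<inter> space S \<in> sets S"
      using cell_S by simp
  qed simp
  have "(\<lambda>p. (fst p, snd p)) \<in> borel_measurable S"
  proof (rule borel_measurable_Pair)
    show "fst \<in> borel_measurable S"
      using digit unfolding measurable_cong_sets[OF refl sets_borel_eq_count_space, symmetric]
      by (rule measurable_coordinatewise_then_product)
    show "snd \<in> borel_measurable S"
      using snd unfolding measurable_cong_sets[OF refl sets_borel_eq_count_space] .
  qed
  then have id: "(\<lambda>p. p) \<in> borel_measurable S"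
    by simp
  show "sets (skew_space n d) \<subseteq> sigma_sets ?\<Omega> ?E"
  proof
    fix A assume "A \<in> sets (skew_space n d)"
    then obtain B where "B \<in> sets borel" "A = ?\<Omega> \<inter> B"
      by (auto simp: skew_space_def sets_restrict_space)
    then show "A \<in> sigma_sets ?\<Omega> ?E"
      using measurable_sets[OF id] S by (auto simp: Int_commute)
  qed
  show "sigma_sets ?\<Omega> ?E \<subseteq> sets (skew_space n d)"
    using cell_sets[OF n, of d] by (intro sets.sigma_sets_subset'[of _ "skew_space n d" ?\<Omega>])
      (auto simp: sets.top[of "skew_space n d", simplified])
qed

text \<open>Two cells are nested or disjoint: the deeper one lies in the single cell of level
  \<open>M\<close> with index \<open>v' mod n ^ M\<close>.\<close>

lemma Int_stable_cells:
  assumes "n > 0"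
  shows "Int_stable {cell n d N w m | N w m. True}"
proof -
  have *: "\<exists>N w m. cell n d M v k \<inter> cell n d M' v' k' = cell n d N w m"
    if "M \<le> M'" for M v k M' v' k'
  proof -
    have "prefix_value n M (fst p) = v' mod n ^ M" if "p \<in> cell n d M' v' k'" for p
      using that prefix_value_mod[of "fst p" n M M'] \<open>M \<le> M'\<close> assms by (auto simp: cell_def)
    then have sub: "cell n d M' v' k' \<subseteq> cell n d M (v' mod n ^ M) k'"
      by (auto simp: cell_def)
    show ?thesis
    proof (cases "v = v' mod n ^ M \<and> k = k'")
      case True
      then show ?thesis
        using sub by blast
    next
      case False
      \<comment> \<open>\<open>cell n d 0 1 0\<close> is a name for the empty set, since every
        prefix value at level 0 is 0.\<close>
      then have "cell n d M v k \<inter> cell n d M' v' k' = cell n d 0 1 0"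
        using sub by (auto simp: cell_def)
      then show ?thesis by blast
    qed
  qed
  show ?thesis
  proof (rule Int_stableI)
    fix A B assume "A \<in> {cell n d N w m | N w m. True}" "B \<in> {cell n d N w m | N w m. True}"
    then obtain M v k M' v' k' where "A = cell n d M v k" "B = cell n d M' v' k'"
      by blast
    then show "A \<inter> B \<in> {cell n d N w m | N w m. True}"
      using *[of M M' v k v' k'] *[of M' M v' k' v k] by (cases "M \<le> M'") (auto simp: Int_commute)
  qed
qed

lemma skew_measure_eqI:
  assumes n: "n > 0"
    and M: "prob_space M" "sets M = sets (skew_space n d)"
    and M': "prob_space M'" "sets M' = sets (skew_space n d)"
    and eq: "\<And>N w m. w < n ^ N \<Longrightarrow> m \<in> {1..d} \<Longrightarrow>
      measure M (cell n d N w m) = measure M' (cell n d N w m)"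
  shows "M = M'"
proof -
  interpret M: prob_space M by fact
  interpret M': prob_space M' by fact
  let ?\<Omega> = "digit_seqs n \<times> {1..d}" and ?E = "{cell n d N w m | N w m. True}"
  show ?thesis
  proof (rule measure_eqI_generator_eq_countable[of ?E ?\<Omega> _ _ "cell n d 0 0 ` {1..d}"])
    show "Int_stable ?E" by (rule Int_stable_cells[OF n])
    show "?E \<subseteq> Pow ?\<Omega>" by (auto simp: cell_def)
    show "sets M = sigma_sets ?\<Omega> ?E" "sets M' = sigma_sets ?\<Omega> ?E"
      using M M' sets_skew_space[OF n, of d] by simp_all
    fix X assume "X \<in> ?E"
    then obtain N w m where X: "X = cell n d N w m" by blast
    have "X = {}" if "\<not> (w < n ^ N \<and> m \<in> {1..d})"
      using that prefix_value_less[OF _ n] by (auto simp: X cell_def)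
    then show "emeasure M X = emeasure M' X"
      using eq[of w N m] by (cases "w < n ^ N \<and> m \<in> {1..d}")
        (auto simp: X M.emeasure_eq_measure M'.emeasure_eq_measure)
  next
    show "cell n d 0 0 ` {1..d} \<subseteq> ?E" by blast
    show "\<Union> (cell n d 0 0 ` {1..d}) = ?\<Omega>" by (auto simp: cell_def)
  qed simp_all
qed

lemma measure_cell_split:
  assumes n: "n > 0" and M: "prob_space M" "sets M = sets (skew_space n d)" and w: "w < n ^ N"
  shows "measure M (cell n d N w m) = (\<Sum>a<n. measure M (cell n d (Suc N) (a * n ^ N + w) m))"
proof -
  interpret M: prob_space M by fact
  have "cell n d N w m = (\<Union>a<n. cell n d (Suc N) (a * n ^ N + w) m)"
  proof (intro equalityI subsetI)
    fix p assume "p \<in> cell n d N w m"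
    then show "p \<in> (\<Union>a<n. cell n d (Suc N) (a * n ^ N + w) m)"
      using digit_seqsD[of "fst p" n "Suc N"]
      by (auto simp: cell_def prefix_value_Suc intro!: bexI[of _ "fst p (Suc N)"])
  next
    fix p assume "p \<in> (\<Union>a<n. cell n d (Suc N) (a * n ^ N + w) m)"
    then show "p \<in> cell n d N w m"
      using prefix_value_mod[of "fst p" n N "Suc N"] n w by (auto simp: cell_def)
  qed
  moreover have "disjoint_family_on (\<lambda>a. cell n d (Suc N) (a * n ^ N + w) m) {..<n}"
    using n by (auto simp: disjoint_family_on_def cell_def)
  ultimately show ?thesis
    using cell_sets[OF n] M(2) by (simp add: M.finite_measure_finite_Union image_subset_iff)
qed

lemma sum_measure_cell_0:
  assumes n: "n > 0" and M: "prob_space M" "sets M = sets (skew_space n d)"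
  shows "(\<Sum>m\<in>{1..d}. measure M (cell n d 0 0 m)) = 1"
proof -
  interpret M: prob_space M by fact
  have "space M = (\<Union>m\<in>{1..d}. cell n d 0 0 m)"
    using sets_eq_imp_space_eq[OF M(2)] by (auto simp: cell_def)
  moreover have "disjoint_family_on (\<lambda>m. cell n d 0 0 m) {1..d}"
    by (auto simp: disjoint_family_on_def cell_def)
  ultimately show ?thesis
    using cell_sets[OF n] M(2) M.prob_space
    by (simp add: M.finite_measure_finite_Union[symmetric] image_subset_iff)
qed

section \<open>Invariant measures\<close>

text \<open>Since \<open>Suc w < n ^ N\<close>, the addition does not wrap around, so preimages have
  prefix value exactly \<open>w\<close>. On them the carry index is constant, and a single injective
  permutation acts on the fibre.\<close>

lemma skew_product_cell_vimage:
  assumes n: "n \<ge> 2" and w: "Suc w < n ^ N" and m: "m \<in> {1..d}"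
    and perm: "\<psi> (free_gen (carry_level n (Suc w))) permutes {1..d}"
  shows "{p \<in> space (skew_space n d).
      \<exists>q\<in>cell n d N (Suc w) (\<psi> (free_gen (carry_level n (Suc w))) m). skew_product n \<psi> p = Some q} =
    cell n d N w m" (is "?V = _")
proof (intro equalityI subsetI)
  fix p assume "p \<in> ?V"
  then obtain x k where p: "p = (x, snd p)" "x \<in> digit_seqs n" "snd p \<in> {1..d}"
    and k: "carry_index n x = enat k"
    and val: "prefix_value n N (odometer n x) = Suc w"
    and fib: "\<psi> (free_gen k) (snd p) = \<psi> (free_gen (carry_level n (Suc w))) m"
    by (cases p) (auto simp: skew_product_def cell_def split: enat.splits)
  have "Suc (prefix_value n N x) mod n ^ N = Suc w"
    using prefix_value_odometer[OF p(2) n] val by simp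
  moreover have "Suc (prefix_value n N x) \<le> n ^ N"
    using prefix_value_less[OF p(2), of N] n by simp
  ultimately have x: "prefix_value n N x = w"
    by (cases "Suc (prefix_value n N x) = n ^ N") auto
  then have "k = carry_level n (Suc w)"
    using carry_index_eq_carry_level[OF p(2) n, of N] w k by simp
  then have "snd p = m"
    using fib inj_eq[OF permutes_inj[OF perm]] by simp
  then show "p \<in> cell n d N w m"
    using p x by (auto simp: cell_def intro: prod_eqI)
next
  fix p assume p: "p \<in> cell n d N w m"
  then obtain x where x: "p = (x, m)" "x \<in> digit_seqs n" "prefix_value n N x = w"
    by (cases p) (auto simp: cell_def)
  have k: "carry_index n x = enat (carry_level n (Suc w))"
    using carry_index_eq_carry_level[OF x(2) n, of N] w x(3) by simp
  have "odometer n x \<in> digit_seqs n" "prefix_value n N (odometer n x) = Suc w"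
    using odometer_digit_seqs[OF x(2) n] prefix_value_odometer[OF x(2) n, of N] w x(3) by auto
  then show "p \<in> ?V"
    using x k m permutes_in_image[OF perm, of m] by (simp add: skew_product_def cell_def)
qed

lemma cocycle_Hom_plus:
  assumes "subgroup G (sym_group d)" "n \<ge> 2" "\<psi> \<in> Hom_plus d G"
  shows "cocycle n (\<lambda>i. \<psi> (free_gen i)) w permutes {1..d}"
  using assms by (intro perm_subgroupD(1)[of G] cocycle_in_subgroup Hom_plus_generator)

text \<open>The cell of index 0 over \<open>m\<close> is transported step by step; invariance
  preserves its mass at each of the \<open>w\<close> steps.\<close>

lemma invariant_cell:
  assumes G: "subgroup G (sym_group d)" and n: "n \<ge> 2" and \<psi>: "\<psi> \<in> Hom_plus d G"
    and inv: "invariant_prob (skew_space n d) (skew_product n \<psi>) \<mu>"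
    and w: "w < n ^ N" and m: "m \<in> {1..d}"
  shows "measure \<mu> (cell n d N w (cocycle n (\<lambda>i. \<psi> (free_gen i)) w m)) = measure \<mu> (cell n d N 0 m)"
  using w
proof (induction w)
  case (Suc w)
  let ?m = "cocycle n (\<lambda>i. \<psi> (free_gen i)) w m"
  have m': "?m \<in> {1..d}"
    using permutes_in_image[OF cocycle_Hom_plus[OF G n \<psi>]] m by blast
  have "carry_level n (Suc w) \<ge> 1"
    using carry_level_bounds[OF _ Suc.prems] by simp
  then have perm: "\<psi> (free_gen (carry_level n (Suc w))) permutes {1..d}"
    using Hom_plus_generator[OF \<psi>] by (intro perm_subgroupD(1)[OF G])
  have "emeasure \<mu> (cell n d N (Suc w) (\<psi> (free_gen (carry_level n (Suc w))) ?m)) =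
      emeasure \<mu> (cell n d N w ?m)"
    unfolding skew_product_cell_vimage[of n w N ?m d \<psi>, OF n Suc.prems m' perm, symmetric]
    using inv n unfolding invariant_prob_def by (simp add: cell_sets)
  then show ?case
    using Suc by (simp add: measure_def)
qed simp

lemma invariant_measure_cell:
  assumes G: "subgroup G (sym_group d)" and n: "n \<ge> 2" and d: "d \<ge> 1"
    and \<psi>: "\<psi> \<in> Hom_plus d G"
    and trans: "\<forall>i\<in>{1..d}. \<forall>j\<in>{1..d}. \<exists>g\<in>set L. g i = j"
    and block: "\<forall>N0. \<exists>N\<ge>N0. \<forall>r<length L. cocycle n (\<lambda>i. \<psi> (free_gen i)) (n ^ (N + r)) = L ! r"
    and inv: "invariant_prob (skew_space n d) (skew_product n \<psi>) \<mu>"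
    and w: "w < n ^ N" and m: "m \<in> {1..d}"
  shows "measure \<mu> (cell n d N w m) = 1 / real (d * n ^ N)"
proof -
  let ?F = "cocycle n (\<lambda>i. \<psi> (free_gen i))"
  have \<mu>: "prob_space \<mu>" "sets \<mu> = sets (skew_space n d)"
    using inv by (auto simp: invariant_prob_def)
  interpret prob_space \<mu> by fact
  note perm = cocycle_Hom_plus[OF G n \<psi>]
  \<comment> \<open>For \<open>a < n\<close>, the cell of index \<open>a * n ^ N\<close> over
    \<open>m\<close> is reached from the cell of index 0 over \<open>(s N ^^ a) m\<close>, whence
    the inverse.\<close>
  define s where "s N = Hilbert_Choice.inv (?F (n ^ N))" for N
  define q where "q N m = n ^ N * measure \<mu> (cell n d N 0 m)" for N m
  have s: "s N m \<in> {1..d}" if "m \<in> {1..d}" for N m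
    unfolding s_def using permutes_in_image[OF permutes_inv[OF perm]] that by blast
  have sp: "(s N ^^ a) m \<in> {1..d}" if "m \<in> {1..d}" for N a m
    using that s by (induction a) auto
  have cancel: "(?F (n ^ N) ^^ a) ((s N ^^ a) m) = m" for N a m
  proof (induction a arbitrary: m)
    case (Suc a)
    have "(?F (n ^ N) ^^ Suc a) ((s N ^^ Suc a) m) = ?F (n ^ N) ((?F (n ^ N) ^^ a) ((s N ^^ a) (s N m)))"
      by (simp add: funpow_swap1)
    then show ?case
      using Suc.IH permutes_inverses(1)[OF perm] by (simp add: s_def)
  qed simp
  have avg: "q N m = (\<Sum>a<n. q (Suc N) ((s N ^^ a) m)) / n" if m: "m \<in> {1..d}" for N m
  proof -
    have "measure \<mu> (cell n d N 0 m) = (\<Sum>a<n. measure \<mu> (cell n d (Suc N) (a * n ^ N) m))"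
      using measure_cell_split[OF _ \<mu>, of 0 N m] n by simp
    also have "\<dots> = (\<Sum>a<n. measure \<mu> (cell n d (Suc N) 0 ((s N ^^ a) m)))"
    proof (intro sum.cong refl)
      fix a assume a: "a \<in> {..<n}"
      then have "a * n ^ N < n ^ Suc N"
        using n by simp
      from invariant_cell[OF G n \<psi> inv this sp[OF m, of a N]]
      show "measure \<mu> (cell n d (Suc N) (a * n ^ N) m) =
          measure \<mu> (cell n d (Suc N) 0 ((s N ^^ a) m))"
        using a n by (simp add: cocycle_mult cancel)
    qed
    finally show ?thesis
      using n by (simp add: q_def sum_distrib_left sum_divide_distrib)
  qed
  have hit: "\<exists>N\<ge>N0. \<forall>i\<in>{1..d}. \<forall>j\<in>{1..d}. \<exists>r<length L. s (N + r) i = j" for N0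
  proof -
    obtain N where N: "N \<ge> N0" "\<And>r. r < length L \<Longrightarrow> ?F (n ^ (N + r)) = L ! r"
      using block by blast
    have "\<exists>r<length L. s (N + r) i = j" if ij: "i \<in> {1..d}" "j \<in> {1..d}" for i j
    proof -
      \<comment> \<open>Transitivity is used from \<open>j\<close> to \<open>i\<close>, because
        \<open>s\<close> inverts the cocycle.\<close>
      obtain r where r: "r < length L" "(L ! r) j = i"
        using trans ij by (metis in_set_conv_nth)
      then have "s (N + r) i = j"
        using permutes_inverses(2)[OF perm, of "n ^ (N + r)" j] N(2)[OF r(1)] by (simp add: s_def)
      then show ?thesis using r(1) by blast
    qed
    then show ?thesis using N(1) by blast
  qed
  \<comment> \<open>The \<open>n ^ N\<close> cells visited from index 0 over \<open>m\<close> are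
    disjoint and equally heavy, so \<open>q N m\<close> is the mass of their union.\<close>
  have bound: "q N m \<in> {0..1}" if m: "m \<in> {1..d}" for N m
  proof -
    have "q N m = (\<Sum>w<n ^ N. measure \<mu> (cell n d N w (?F w m)))"
      using invariant_cell[OF G n \<psi> inv _ m] by (simp add: q_def)
    also have "\<dots> = measure \<mu> (\<Union>w<n ^ N. cell n d N w (?F w m))"
    proof (rule finite_measure_finite_Union[symmetric])
      show "(\<lambda>w. cell n d N w (?F w m)) ` {..<n ^ N} \<subseteq> events"
        using cell_sets[of n d] n \<mu>(2) by auto
      show "disjoint_family_on (\<lambda>w. cell n d N w (?F w m)) {..<n ^ N}"
        by (auto simp: disjoint_family_on_def cell_def)
    qed simp
    also have "\<dots> \<le> 1"
      by (rule prob_le_1)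
    finally show ?thesis
      by (simp add: q_def)
  qed
  have const: "q N i = q N j" if "i \<in> {1..d}" "j \<in> {1..d}" for N i j
    using that d by (intro averages_constant[of "{1..d}" n s q "length L"] n s avg hit bound) auto
  have Suc_q: "q N m = q (Suc N) m" if m: "m \<in> {1..d}" for N m
  proof -
    have "(\<Sum>a<n. q (Suc N) ((s N ^^ a) m)) = (\<Sum>a<n. q (Suc N) m)"
      using m sp by (intro sum.cong refl const) auto
    then show ?thesis
      unfolding avg[OF m] using n by simp
  qed
  have q0: "q N m = q 0 m" if m: "m \<in> {1..d}" for N m
    using Suc_q[OF m] by (induction N) auto
  have uniform: "q N m = 1 / d" if m: "m \<in> {1..d}" for N m
  proof -
    have "1 = (\<Sum>i\<in>{1..d}. q 0 i)"
      using sum_measure_cell_0[OF _ \<mu>] n by (simp add: q_def)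
    also have "\<dots> = (\<Sum>i\<in>{1..d}. q 0 m)"
      using m by (intro sum.cong refl const) auto
    finally show ?thesis
      using d q0[OF m, of N] by (simp add: field_simps)
  qed
  \<comment> \<open>The fibre point over index 0 from which the cell of index \<open>w\<close> over
    \<open>m\<close> is reached.\<close>
  define m' where "m' = Hilbert_Choice.inv (?F w) m"
  have m': "m' \<in> {1..d}" "?F w m' = m"
    using permutes_in_image[OF permutes_inv[OF perm]] permutes_inverses(1)[OF perm] m
    by (auto simp: m'_def)
  have "measure \<mu> (cell n d N w m) = q N m' / n ^ N"
    using invariant_cell[OF G n \<psi> inv w m'(1)] m'(2) n by (simp add: q_def)
  then show ?thesis
    using uniform[OF m'(1)] by simp
qed

section \<open>The uniform measure\<close>

definition uniform_skew :: "nat \<Rightarrow> nat \<Rightarrow> ((nat \<Rightarrow> nat) \<times> nat) measure" where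
  "uniform_skew n d =
     distr (PiM {1..} (\<lambda>_. uniform_count_measure {0..<n}) \<Otimes>\<^sub>M uniform_count_measure {1..d})
       (skew_space n d) (\<lambda>p. p)"

text \<open>A cell is a digit cylinder times a fibre point, so its mass is a product. The
  \<open>distr\<close> along the identity only replaces the product sigma-algebra by that of
  \<open>skew_space\<close>; its measurability is checked on cells.\<close>

lemma uniform_skew:
  assumes n: "n \<ge> 2" and d: "d \<ge> 1"
  shows "prob_space (uniform_skew n d)" (is ?prob)
    and "sets (uniform_skew n d) = sets (skew_space n d)"
    and "w < n ^ N \<Longrightarrow> m \<in> {1..d} \<Longrightarrow>
      measure (uniform_skew n d) (cell n d N w m) = 1 / real (d * n ^ N)"
proof -
  let ?U = "uniform_count_measure {0..<n}" and ?D = "uniform_count_measure {1..d}"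
  let ?P = "PiM {1::nat..} (\<lambda>_. ?U)"
  interpret U: prob_space ?U
    using n by (intro prob_space_uniform_count_measure) auto
  interpret D: prob_space ?D
    using d by (intro prob_space_uniform_count_measure) auto
  interpret product_prob_space "\<lambda>_. ?U" "{1::nat..}"
    by unfold_locales
  interpret P: prob_space ?P
    by (rule prob_space_PiM) (rule U.prob_space_axioms)
  interpret PD: pair_prob_space ?P ?D ..
  have space: "space (?P \<Otimes>\<^sub>M ?D) = digit_seqs n \<times> {1..d}"
    by (simp add: space_pair_measure space_PiM space_uniform_count_measure digit_seqs_def)
  have cells: "cell n d N w m \<in> sets (?P \<Otimes>\<^sub>M ?D) \<and>
      emeasure (?P \<Otimes>\<^sub>M ?D) (cell n d N w m) = ennreal (1 / real (d * n ^ N))"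
    if w: "w < n ^ N" and m: "m \<in> {1..d}" for N w m
  proof -
    obtain e where e: "e \<in> digit_seqs n" "prefix_value n N e = w"
      using ex_prefix_value[OF w] n by auto
    have sing: "{e i} \<in> sets ?U" if "i \<in> {1..N}" for i
      using digit_seqsD[OF e(1), of i] that by (simp add: sets_uniform_count_measure)
    let ?C = "{x \<in> space ?P. \<forall>i\<in>{1..N}. x i \<in> {e i}}"
    have "?C = prod_emb {1..} (\<lambda>_. ?U) {1..N} (\<Pi>\<^sub>E i\<in>{1..N}. {e i})"
      by (auto simp: prod_emb_def space_PiM Pi_iff)
    then have C: "?C \<in> sets ?P"
      using sing by (auto intro!: sets_PiM_I)
    have "emeasure ?P ?C = (\<Prod>i\<in>{1..N}. emeasure ?U {e i})"
      using sing by (intro emeasure_PiM_Collect) auto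
    also have "\<dots> = (\<Prod>i\<in>{1..N}. ennreal (1 / n))"
      using digit_seqsD[OF e(1)] by (intro prod.cong) (auto simp: emeasure_uniform_count_measure)
    finally have "emeasure ?P ?C = ennreal ((1 / n) ^ N)"
      by (simp add: ennreal_power)
    moreover have "emeasure ?D {m} = ennreal (1 / d)"
      using m by (simp add: emeasure_uniform_count_measure)
    moreover have m_sets: "{m} \<in> sets ?D"
      using m by (simp add: sets_uniform_count_measure)
    ultimately have "emeasure (?P \<Otimes>\<^sub>M ?D) (?C \<times> {m}) = ennreal ((1 / n) ^ N) * ennreal (1 / d)"
      by (simp only: D.emeasure_pair_measure_Times[OF C m_sets])
    also have "\<dots> = ennreal (1 / real (d * n ^ N))"
      by (simp add: ennreal_mult[symmetric] power_one_over mult.commute)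
    finally have "emeasure (?P \<Otimes>\<^sub>M ?D) (?C \<times> {m}) = ennreal (1 / real (d * n ^ N))" .
    moreover have "cell n d N w m = ?C \<times> {m}"
      using cell_eq_digits[OF e(1), of d N m] n m
      by (auto simp: e(2) space_PiM space_uniform_count_measure digit_seqs_def)
    ultimately show ?thesis
      using C m_sets by (simp add: pair_measureI)
  qed
  have cell_empty': "cell n d N w m = {}" if "\<not> (w < n ^ N \<and> m \<in> {1..d})" for N w m
    using that prefix_value_less[of _ n N] n by (auto simp: cell_def)
  have id: "(\<lambda>p. p) \<in> ?P \<Otimes>\<^sub>M ?D \<rightarrow>\<^sub>M skew_space n d"
  proof (rule measurable_sigma_sets[OF sets_skew_space])
    fix A assume "A \<in> {cell n d N w m | N w m. True}"
    then obtain N w m where A: "A = cell n d N w m" by blast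
    have "A \<in> sets (?P \<Otimes>\<^sub>M ?D)"
      using cells[of w N m] cell_empty'[of w N m] unfolding A by (cases "w < n ^ N \<and> m \<in> {1..d}") auto
    then show "(\<lambda>p. p) -` A \<inter> space (?P \<Otimes>\<^sub>M ?D) \<in> sets (?P \<Otimes>\<^sub>M ?D)"
      by simp
  qed (use n space in \<open>auto simp: cell_def\<close>)
  show ?prob
    unfolding uniform_skew_def by (rule PD.prob_space_distr[OF id])
  show "sets (uniform_skew n d) = sets (skew_space n d)"
    by (simp add: uniform_skew_def)
  show "measure (uniform_skew n d) (cell n d N w m) = 1 / real (d * n ^ N)"
    if "w < n ^ N" "m \<in> {1..d}"
  proof -
    have "(\<lambda>p. p) -` cell n d N w m \<inter> space (?P \<Otimes>\<^sub>M ?D) = cell n d N w m"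
      unfolding space by (auto simp: cell_def)
    then have "measure (uniform_skew n d) (cell n d N w m) = measure (?P \<Otimes>\<^sub>M ?D) (cell n d N w m)"
      using n measure_distr[OF id cell_sets, of N w m] by (simp only: uniform_skew_def)
    also have "\<dots> = 1 / real (d * n ^ N)"
      unfolding measure_def cells[OF that, THEN conjunct2] by simp
    finally show ?thesis .
  qed
qed

section \<open>Invariance of the uniform measure\<close>

text \<open>A total extension of the skew product, so that invariance can be phrased as a
  pushforward. Over the point of infinite carry the fibre coordinate is kept.\<close>

definition total_skew ::
    "nat \<Rightarrow> ((bool \<times> nat) list \<Rightarrow> nat \<Rightarrow> nat) \<Rightarrow> (nat \<Rightarrow> nat) \<times> nat \<Rightarrow> (nat \<Rightarrow> nat) \<times> nat" where
  "total_skew n \<psi> p = (odometer n (fst p),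
     case carry_index n (fst p) of enat k \<Rightarrow> \<psi> (free_gen k) (snd p) | \<infinity> \<Rightarrow> snd p)"

lemma skew_product_eq_Some_iff:
  "skew_product n \<psi> p = Some q \<longleftrightarrow> carry_index n (fst p) \<noteq> \<infinity> \<and> q = total_skew n \<psi> p"
  by (cases p) (auto simp: skew_product_def total_skew_def split: enat.splits)

lemma total_skew_space:
  assumes G: "subgroup G (sym_group d)" and n: "n \<ge> 2" and \<psi>: "\<psi> \<in> Hom_plus d G"
    and p: "p \<in> digit_seqs n \<times> {1..d}"
  shows "total_skew n \<psi> p \<in> digit_seqs n \<times> {1..d}"
proof -
  have "\<psi> (free_gen k) (snd p) \<in> {1..d}" if "carry_index n (fst p) = enat k" for k
  proof -
    have "\<psi> (free_gen k) permutes {1..d}"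
      using that carry_index_eq_enat_iff[of n "fst p" k] Hom_plus_generator[OF \<psi>, of k]
      by (intro perm_subgroupD(1)[OF G]) auto
    then show ?thesis
      using permutes_in_image[of _ "{1..d}" "snd p"] p by auto
  qed
  then show ?thesis
    using p odometer_digit_seqs[of "fst p" n] n
    by (auto simp: total_skew_def split: enat.splits)
qed

lemma measurable_carry_index:
  "(\<lambda>p. carry_index n (fst p)) \<in> skew_space n d \<rightarrow>\<^sub>M count_space UNIV"
  unfolding measurable_count_space_eq2_countable
proof (intro conjI ballI)
  note [measurable] = measurable_skew_digit
  fix k
  have "{p \<in> space (skew_space n d). carry_index n (fst p) = k} \<in> sets (skew_space n d)"
  proof (cases k)
    case (enat j)
    show ?thesis
      unfolding enat carry_index_eq_enat_iff by measurable
  next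
    case infinity
    show ?thesis
      unfolding infinity carry_index_eq_infinity_iff by measurable
  qed
  also have "{p \<in> space (skew_space n d). carry_index n (fst p) = k} =
      (\<lambda>p. carry_index n (fst p)) -` {k} \<inter> space (skew_space n d)"
    by auto
  finally show "(\<lambda>p. carry_index n (fst p)) -` {k} \<inter> space (skew_space n d) \<in> sets (skew_space n d)" .
qed simp

lemma measurable_prefix_value:
  assumes "n > 0"
  shows "(\<lambda>p. prefix_value n N (fst p)) \<in> skew_space n d \<rightarrow>\<^sub>M count_space UNIV"
  unfolding measurable_count_space_eq2_countable
proof (intro conjI ballI)
  fix w
  have "(\<lambda>p. prefix_value n N (fst p)) -` {w} \<inter> space (skew_space n d) =
      (\<Union>m\<in>{1..d}. cell n d N w m)"
    by (auto simp: cell_def)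
  then show "(\<lambda>p. prefix_value n N (fst p)) -` {w} \<inter> space (skew_space n d) \<in> sets (skew_space n d)"
    using cell_sets[OF assms] by auto
qed simp

lemma measurable_total_skew:
  assumes G: "subgroup G (sym_group d)" and n: "n \<ge> 2" and \<psi>: "\<psi> \<in> Hom_plus d G"
  shows "total_skew n \<psi> \<in> skew_space n d \<rightarrow>\<^sub>M skew_space n d"
proof (rule measurable_sigma_sets[OF sets_skew_space])
  have n0: "n > 0" using n by simp
  fix A assume "A \<in> {cell n d N w m | N w m. True}"
  then obtain N w m where A: "A = cell n d N w m" by blast
  have "total_skew n \<psi> -` A \<inter> space (skew_space n d) =
      {p \<in> space (skew_space n d).
        Suc (prefix_value n N (fst p)) mod n ^ N = w \<and> snd (total_skew n \<psi> p) = m}"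
  proof -
    have "total_skew n \<psi> p \<in> A \<longleftrightarrow>
        Suc (prefix_value n N (fst p)) mod n ^ N = w \<and> snd (total_skew n \<psi> p) = m"
      if p: "p \<in> space (skew_space n d)" for p
    proof -
      have "prefix_value n N (fst (total_skew n \<psi> p)) = Suc (prefix_value n N (fst p)) mod n ^ N"
        using prefix_value_odometer[of "fst p" n N] n p by (auto simp: total_skew_def)
      then show ?thesis
        using total_skew_space[OF G n \<psi>, of p] p by (simp add: A cell_def)
    qed
    then show ?thesis by blast
  qed
  also have "\<dots> \<in> sets (skew_space n d)"
  proof -
    have [measurable]: "(\<lambda>p. snd (total_skew n \<psi> p)) \<in> skew_space n d \<rightarrow>\<^sub>M count_space UNIV"
      unfolding total_skew_def snd_conv
      by (rule measurable_case_enat[OF measurable_carry_index _ measurable_skew_snd])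
        (rule measurable_compose[OF measurable_skew_snd measurable_count_space])
    have [measurable]: "(\<lambda>p. Suc (prefix_value n N (fst p)) mod n ^ N) \<in> skew_space n d \<rightarrow>\<^sub>M count_space UNIV"
      by (rule measurable_compose[OF measurable_prefix_value[OF n0] measurable_count_space])
    show ?thesis by measurable
  qed
  finally show "total_skew n \<psi> -` A \<inter> space (skew_space n d) \<in> sets (skew_space n d)" .
qed (use n total_skew_space[OF G n \<psi>] in \<open>auto simp: cell_def\<close>)

text \<open>A point of infinite carry is sent to prefix value 0, hence outside the target cell, and
  the total and partial preimages agree. An unspecified \<open>m'\<close> suffices because the
  uniform measure gives equal mass to all cells of a level.\<close>

lemma distr_total_skew_cell:
  assumes G: "subgroup G (sym_group d)" and n: "n \<ge> 2" and \<psi>: "\<psi> \<in> Hom_plus d G"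
    and \<nu>: "sets \<nu> = sets (skew_space n d)"
    and w: "Suc w < n ^ N" and m: "m \<in> {1..d}"
  shows "\<exists>m'\<in>{1..d}. measure (distr \<nu> (skew_space n d) (total_skew n \<psi>)) (cell n d N (Suc w) m) =
    measure \<nu> (cell n d N w m')"
proof -
  let ?g = "\<psi> (free_gen (carry_level n (Suc w)))"
  have "carry_level n (Suc w) \<ge> 1"
    using carry_level_bounds[OF _ w] by simp
  then have perm: "?g permutes {1..d}"
    using Hom_plus_generator[OF \<psi>] by (intro perm_subgroupD(1)[OF G])
  define m' where "m' = Hilbert_Choice.inv ?g m"
  have m': "m' \<in> {1..d}" "?g m' = m"
    using permutes_in_image[OF permutes_inv[OF perm]] permutes_inverses(1)[OF perm] m
    by (auto simp: m'_def)
  have "carry_index n (fst p) \<noteq> \<infinity>"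
    if p: "p \<in> space (skew_space n d)" "total_skew n \<psi> p \<in> cell n d N (Suc w) m" for p
  proof
    assume "carry_index n (fst p) = \<infinity>"
    then have "prefix_value n N (odometer n (fst p)) = 0"
      by (simp add: prefix_value_def odometer_def)
    then show False
      using p by (simp add: cell_def total_skew_def)
  qed
  then have "total_skew n \<psi> -` cell n d N (Suc w) m \<inter> space (skew_space n d) =
      {p \<in> space (skew_space n d). \<exists>q\<in>cell n d N (Suc w) m. skew_product n \<psi> p = Some q}"
    unfolding skew_product_eq_Some_iff by blast
  also have "\<dots> = cell n d N w m'"
    using skew_product_cell_vimage[of n w N m' d \<psi>, OF n w m'(1) perm] unfolding m'(2) .
  finally have "total_skew n \<psi> -` cell n d N (Suc w) m \<inter> space \<nu> = cell n d N w m'"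
    using sets_eq_imp_space_eq[OF \<nu>] by simp
  moreover have "total_skew n \<psi> \<in> \<nu> \<rightarrow>\<^sub>M skew_space n d"
    using measurable_total_skew[OF G n \<psi>] measurable_cong_sets[OF \<nu> refl] by blast
  ultimately show ?thesis
    using m'(1) n by (intro bexI[of _ m']) (simp_all add: measure_distr cell_sets)
qed

text \<open>
  The cells with \<open>w = 0\<close> have no convenient preimage. Their excess mass does not depend on \<open>N\<close>,
  hence is nonnegative because the uniform mass of the cells tends to \<open>0\<close>; and it adds up to
  \<open>0\<close> over the fibre.
\<close>

lemma measure_cell_eqI_nonzero:
  assumes n: "n \<ge> 2" and d: "d \<ge> 1" and M: "prob_space M" "sets M = sets (skew_space n d)"
    and pos: "\<And>N w m. 0 < w \<Longrightarrow> w < n ^ N \<Longrightarrow> m \<in> {1..d} \<Longrightarrow>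
      measure M (cell n d N w m) = 1 / real (d * n ^ N)"
    and w: "w < n ^ N" and m: "m \<in> {1..d}"
  shows "measure M (cell n d N w m) = 1 / real (d * n ^ N)"
proof (cases "w = 0")
  case True
  define \<delta> where "\<delta> N m = measure M (cell n d N 0 m) - 1 / real (d * n ^ N)" for N m
  \<comment> \<open>The subcells with \<open>a \<ge> 1\<close> have positive index and known mass,
    so the entire excess passes to the subcell of index 0.\<close>
  have Suc_\<delta>: "\<delta> N m = \<delta> (Suc N) m" if m: "m \<in> {1..d}" for N m
  proof -
    have "measure M (cell n d N 0 m) = (\<Sum>a<n. measure M (cell n d (Suc N) (a * n ^ N) m))"
      using measure_cell_split[OF _ M, of 0 N m] n by simp
    also have "{..<n} = insert 0 {1..<n}"
      using n by auto
    also have "(\<Sum>a\<in>\<dots>. measure M (cell n d (Suc N) (a * n ^ N) m)) =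
        measure M (cell n d (Suc N) 0 m) + (\<Sum>a\<in>{1..<n}. measure M (cell n d (Suc N) (a * n ^ N) m))"
      by simp
    also have "(\<Sum>a\<in>{1..<n}. measure M (cell n d (Suc N) (a * n ^ N) m)) =
        (\<Sum>a\<in>{1..<n}. 1 / real (d * n ^ Suc N))"
      using m n by (intro sum.cong refl pos) auto
    also have "\<dots> = (real n - 1) * (1 / real (d * n ^ Suc N))"
      using n by (simp add: of_nat_diff)
    also have "\<dots> = 1 / real (d * n ^ N) - 1 / real (d * n ^ Suc N)"
      using n d by (simp add: field_simps)
    finally show ?thesis
      by (simp add: \<delta>_def)
  qed
  have \<delta>_0: "\<delta> N m = \<delta> 0 m" if m: "m \<in> {1..d}" for N m
    using Suc_\<delta>[OF m] by (induction N) auto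
  have nonneg: "\<delta> 0 m \<ge> 0" if m: "m \<in> {1..d}" for m
  proof -
    have "(\<lambda>N. - (1 / real d * (1 / real n) ^ N)) \<longlonglongrightarrow> - (1 / real d * 0)"
      using n by (intro tendsto_intros LIMSEQ_power_zero) auto
    moreover have "- (1 / real d * (1 / real n) ^ N) \<le> \<delta> 0 m" for N
    proof -
      have "- (1 / real (d * n ^ N)) \<le> \<delta> N m"
        using measure_nonneg[of M "cell n d N 0 m"] unfolding \<delta>_def by linarith
      then show ?thesis
        using \<delta>_0[OF m, of N] by (simp add: power_one_over)
    qed
    ultimately show ?thesis
      using tendsto_upperbound[of _ "- (1 / real d * 0)" sequentially "\<delta> 0 m"] by auto
  qed
  have "(\<Sum>m\<in>{1..d}. \<delta> 0 m) = 0"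
    using sum_measure_cell_0[OF _ M] n d by (simp add: \<delta>_def sum_subtractf)
  then have "\<delta> 0 m = 0"
    using sum_nonneg_eq_0_iff[of "{1..d}" "\<delta> 0"] nonneg m by auto
  then show ?thesis
    using \<delta>_0[OF m, of N] True by (simp add: \<delta>_def)
qed (use pos w m in simp)

text \<open>At every level, the points of infinite carry lie in the cells of last index
  \<open>n ^ N - 1\<close>, whose total mass is \<open>(1 / n) ^ N\<close>.\<close>

lemma AE_uniform_skew_carry:
  assumes n: "n \<ge> 2" and d: "d \<ge> 1"
  shows "AE p in uniform_skew n d. carry_index n (fst p) \<noteq> \<infinity>"
proof -
  let ?\<nu> = "uniform_skew n d"
  note \<nu> = uniform_skew[OF n d]
  interpret prob_space ?\<nu> by (rule \<nu>(1))
  let ?Z = "{p \<in> space ?\<nu>. carry_index n (fst p) = \<infinity>}"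
  have space: "space ?\<nu> = digit_seqs n \<times> {1..d}"
    using sets_eq_imp_space_eq[OF \<nu>(2)] by simp
  have Z: "?Z \<in> events"
  proof -
    have "(\<lambda>p. carry_index n (fst p)) -` {\<infinity>} \<inter> space (skew_space n d) \<in> sets (skew_space n d)"
      by (rule measurable_sets[OF measurable_carry_index]) simp
    then show ?thesis
      unfolding \<nu>(2) space by (simp add: vimage_def Int_def conj_commute)
  qed
  have "prob ?Z \<le> (1 / n) ^ N" for N
  proof -
    have "prefix_value n N x = n ^ N - 1" if "carry_index n x = \<infinity>" for x
    proof -
      have "prefix_value n N x = prefix_value n N (\<lambda>i\<in>{1..}. n - 1)"
        using that by (intro prefix_value_cong) (simp add: carry_index_eq_infinity_iff)
      then show ?thesis
        using prefix_value_const[of n N] n by simp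
    qed
    then have "?Z \<subseteq> (\<Union>m\<in>{1..d}. cell n d N (n ^ N - 1) m)"
      by (auto simp: space cell_def)
    moreover have cells: "cell n d N (n ^ N - 1) m \<in> events" for m
      using cell_sets[of n d] n \<nu>(2) by simp
    ultimately have "prob ?Z \<le> prob (\<Union>m\<in>{1..d}. cell n d N (n ^ N - 1) m)"
      by (intro finite_measure_mono) auto
    also have "\<dots> \<le> (\<Sum>m\<in>{1..d}. prob (cell n d N (n ^ N - 1) m))"
      using cells by (intro finite_measure_subadditive_finite) auto
    also have "\<dots> = (\<Sum>m\<in>{1..d}. 1 / real (d * n ^ N))"
      using n by (intro sum.cong refl \<nu>(3)) auto
    also have "\<dots> = (1 / n) ^ N"
      using d by (simp add: power_one_over)
    finally show ?thesis .
  qed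
  moreover have "(\<lambda>N. (1 / real n) ^ N) \<longlonglongrightarrow> 0"
    using n by (intro LIMSEQ_power_zero) auto
  ultimately have "prob ?Z \<le> 0"
    by (intro tendsto_lowerbound[of "\<lambda>N. (1 / real n) ^ N" 0 sequentially]) auto
  then have "emeasure ?\<nu> ?Z = 0"
    by (simp add: emeasure_eq_measure measure_le_0_iff)
  then show ?thesis
    using Z by (intro AE_I[of _ _ ?Z]) auto
qed

text \<open>The pushforward under the total map has the right mass on cells of positive index, which
  by \<open>measure_cell_eqI_nonzero\<close> is enough to identify it. Passing to the partial map
  alters preimages only by a null set.\<close>

lemma invariant_uniform_skew:
  assumes G: "subgroup G (sym_group d)" and n: "n \<ge> 2" and d: "d \<ge> 1" and \<psi>: "\<psi> \<in> Hom_plus d G"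
  shows "invariant_prob (skew_space n d) (skew_product n \<psi>) (uniform_skew n d)"
proof -
  let ?\<nu> = "uniform_skew n d" and ?S = "skew_space n d" and ?T = "total_skew n \<psi>"
  note \<nu> = uniform_skew[OF n d]
  interpret prob_space ?\<nu> by (rule \<nu>(1))
  have n0: "n > 0" using n by simp
  have T: "?T \<in> ?\<nu> \<rightarrow>\<^sub>M ?S"
    using measurable_total_skew[OF G n \<psi>] measurable_cong_sets[OF \<nu>(2) refl] by blast
  have push: "prob_space (distr ?\<nu> ?S ?T)" "sets (distr ?\<nu> ?S ?T) = sets ?S"
    by (simp_all add: prob_space_distr[OF T])
  have "measure (distr ?\<nu> ?S ?T) (cell n d N w m) = 1 / real (d * n ^ N)"
    if w: "0 < w" "w < n ^ N" and m: "m \<in> {1..d}" for N w m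
  proof -
    obtain v where v: "w = Suc v" using w(1) by (cases w) auto
    then show ?thesis
      using distr_total_skew_cell[OF G n \<psi> \<nu>(2) w(2)[unfolded v] m] \<nu>(3)[of v N] w(2) by auto
  qed
  then have "distr ?\<nu> ?S ?T = ?\<nu>"
    using measure_cell_eqI_nonzero[OF n d push] \<nu>(3)
    by (intro skew_measure_eqI[OF n0 push \<nu>(1,2)]) simp
  have "emeasure ?\<nu> {p \<in> space ?S. \<exists>q\<in>A. skew_product n \<psi> p = Some q} = emeasure ?\<nu> A"
    if A: "A \<in> sets ?S" for A
  proof -
    have space: "space ?\<nu> = space ?S"
      by (rule sets_eq_imp_space_eq[OF \<nu>(2)])
    have V: "?T -` A \<inter> space ?\<nu> \<in> events"
      using T A by (rule measurable_sets)
    have C: "{p \<in> space ?\<nu>. carry_index n (fst p) \<noteq> \<infinity>} \<in> events"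
    proof -
      have "(\<lambda>p. carry_index n (fst p)) -` (- {\<infinity>}) \<inter> space ?S \<in> sets ?S"
        by (rule measurable_sets[OF measurable_carry_index]) simp
      then show ?thesis
        unfolding space \<nu>(2) by (simp add: vimage_def Int_def conj_commute)
    qed
    have eq: "{p \<in> space ?S. \<exists>q\<in>A. skew_product n \<psi> p = Some q} =
        (?T -` A \<inter> space ?\<nu>) \<inter> {p \<in> space ?\<nu>. carry_index n (fst p) \<noteq> \<infinity>}"
      unfolding skew_product_eq_Some_iff space by blast
    have "emeasure ?\<nu> {p \<in> space ?S. \<exists>q\<in>A. skew_product n \<psi> p = Some q} =
        emeasure ?\<nu> (?T -` A \<inter> space ?\<nu>)"
      unfolding eq using AE_uniform_skew_carry[OF n d] sets.Int[OF V C] V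
      by (intro emeasure_eq_AE) auto
    also have "\<dots> = emeasure (distr ?\<nu> ?S ?T) A"
      using T A by (simp add: emeasure_distr)
    finally show ?thesis
      using \<open>distr ?\<nu> ?S ?T = ?\<nu>\<close> by simp
  qed
  then show ?thesis
    using \<nu>(1,2) by (simp add: invariant_prob_def)
qed

theorem theorem7:
  fixes n d :: nat and G :: "(nat \<Rightarrow> nat) set"
  assumes "n \<ge> 2" and "d \<ge> 2"
    and "subgroup G (sym_group d)"
    and "\<forall>i\<in>{1..d}. \<forall>j\<in>{1..d}. \<exists>g\<in>G. g i = j"
  shows "AE \<psi> in mu_plus d G. uniquely_ergodic (skew_space n d) (skew_product n \<psi>)"
proof -
  have n: "n > 0" and d: "d \<ge> 1" using assms by auto
  \<comment> \<open>A block listing all of \<open>G\<close> realises every move between fibre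
    points, by transitivity.\<close>
  obtain L where L: "set L = G"
    using finite_list subgroup_sym_group_finite(1)[OF assms(3)] by blast
  have "AE \<psi> in mu_plus d G. \<forall>N0. \<exists>N\<ge>N0. \<forall>r<length L.
      cocycle n (\<lambda>i. \<psi> (free_gen i)) (n ^ (N + r)) = L ! r"
    using L by (intro AE_cocycle_block_occurs[OF assms(3,1)]) simp
  moreover have "AE \<psi> in mu_plus d G. \<psi> \<in> Hom_plus d G"
    using AE_space[of "mu_plus d G"] by simp
  ultimately show ?thesis
  proof eventually_elim
    case (elim \<psi>)
    note \<nu> = uniform_skew[OF assms(1) d]
    have "\<mu> = uniform_skew n d"
      if inv: "invariant_prob (skew_space n d) (skew_product n \<psi>) \<mu>" for \<mu>
    proof (rule skew_measure_eqI[OF n _ _ \<nu>(1,2)])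
      fix N w m assume "w < n ^ N" "m \<in> {1..d}"
      then show "measure \<mu> (cell n d N w m) = measure (uniform_skew n d) (cell n d N w m)"
        using invariant_measure_cell[OF assms(3,1) d elim(2) _ elim(1) inv] assms(4) \<nu>(3) L by simp
    qed (use inv in \<open>auto simp: invariant_prob_def\<close>)
    then show ?case
      using invariant_uniform_skew[OF assms(3,1) d elim(2)] unfolding uniquely_ergodic_def by blast
  qed
qed

end
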